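(* Let $R$ be a commutative clean ring and let $h\in R[t]$ be a monic polynomial of degree $n$. Then the following are equivalent: (1) Every $A\in \mathbf{M}_n(R)$ with characteristic polynomial $\chi(A)=h$ is strongly $\pi$-regular. (2) There exists $A\in \mathbf{M}_n(R)$ with $\chi(A)=h$ which is strongly $\pi$-regular. (3) The polynomial $h$ has a gSP-factorization.
   Context: All rings are unital. $\mathbf{M}_n(R)$ is the ring of $n\times n$ matrices over $R$, $\mathbf{U}(S)$ is the group of units of a ring $S$, $\mathbf{Nil}(S)$ is the nil radical of a commutative ring $S$, and $\chi(A)$ is the characteristic polynomial of a square matrix $A$ over a commutative ring. A ring is clean if each of its elements is the sum of an idempotent and a unit. An element $r$ of a ring $S$ is strongly $\pi$-regular if both chains of one-sided ideals $rS\supseteq r^2S\supseteq r^3S\supseteq\cdots$ and $Sr\supseteq Sr^2\supseteq Sr^3\supseteq\cdots$ terminate (i.e. become stationary). For a commutative ring $S$ and a monic $f\in S[t]$, a factorization $f=h_0p_0$ in $S[t]$ is an SP-factorization if $h_0(0)\in\mathbf{U}(S)$ and $p_0-t^{\deg(p_0)}\in\mathbf{Nil}(S)[t]$. A complete orthogonal set of idempotents of $R$ is a finite set of pairwise orthogonal idempotents of $R$ whose sum is $1$. A monic $h\in R[t]$ has a gSP-factorization if there is a complete orthogonal set of idempotents $\{e_1,\ldots,e_k\}$ of $R$, depending on $h$, such that for each $i=1,\ldots,k$ the polynomial $he_i$ has an SP-factorization in $e_iR[t]$ (where $e_iR$ is regarded as a ring with identity $e_i$). *)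

theory Defs
  imports "Jordan_Normal_Form.Char_Poly" "HOL-Algebra.Coset" "HOL-Algebra.Ring"
begin

definition clean_ring :: "'a::comm_ring_1 itself \<Rightarrow> bool" where
  "clean_ring _ \<longleftrightarrow> (\<forall>a::'a. \<exists>e u. e * e = e \<and> u dvd 1 \<and> a = e + u)"

text \<open>The two cosets below are the principal one-sided ideals generated by the powers of an
  element. The chains start with the first power.\<close>

definition strongly_pi_regular :: "('r, 'm) ring_scheme \<Rightarrow> 'r \<Rightarrow> bool" where
  "strongly_pi_regular S r \<longleftrightarrow> r \<in> carrier S \<and>
    (\<exists>m\<ge>1. \<forall>k\<ge>m. (r [^]\<^bsub>S\<^esub> (k::nat)) <#\<^bsub>S\<^esub> carrier S = (r [^]\<^bsub>S\<^esub> (m::nat)) <#\<^bsub>S\<^esub> carrier S) \<and>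
    (\<exists>m\<ge>1. \<forall>k\<ge>m. carrier S #>\<^bsub>S\<^esub> (r [^]\<^bsub>S\<^esub> (k::nat)) = carrier S #>\<^bsub>S\<^esub> (r [^]\<^bsub>S\<^esub> (m::nat)))"

definition corner_ring :: "'a::comm_ring_1 \<Rightarrow> 'a ring" where
  "corner_ring e =
    \<lparr>carrier = range ((*) e), mult = (*), one = e, zero = 0, add = (+)\<rparr>"

definition nil_radical :: "('r, 'm) ring_scheme \<Rightarrow> 'r set" where
  "nil_radical S = {x \<in> carrier S. \<exists>k::nat. x [^]\<^bsub>S\<^esub> k = \<zero>\<^bsub>S\<^esub>}"

definition polys_over :: "'a::zero set \<Rightarrow> 'a poly set" where
  "polys_over C = {p. \<forall>i. coeff p i \<in> C}"

text \<open>For an idempotent \<open>e\<close>, the polynomial ring over the corner ring of \<open>e\<close> is the subset of the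
  ambient polynomial ring consisting of the polynomials with coefficients in that corner ring; sums,
  products and degrees are those of the ambient ring, while the monic power of the variable of
  exponent \<open>d\<close> is \<open>monom e d\<close>. The case \<open>e = 1\<close> is spelled out in \<open>SP_factorization_1\<close>.\<close>

definition SP_factorization :: "'a::comm_ring_1 \<Rightarrow> 'a poly \<Rightarrow> 'a poly \<Rightarrow> 'a poly \<Rightarrow> bool" where
  "SP_factorization e f h0 p0 \<longleftrightarrow>
    h0 \<in> polys_over (carrier (corner_ring e)) \<and>
    p0 \<in> polys_over (carrier (corner_ring e)) \<and>
    f = h0 * p0 \<and>
    poly h0 0 \<in> Units (corner_ring e) \<and>
    p0 - monom e (degree p0) \<in> polys_over (nil_radical (corner_ring e))"

definition complete_orthogonal_idempotents :: "'a::comm_ring_1 set \<Rightarrow> bool" where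
  "complete_orthogonal_idempotents E \<longleftrightarrow> finite E \<and> (\<forall>e\<in>E. e * e = e) \<and>
    (\<forall>e\<in>E. \<forall>f\<in>E. e \<noteq> f \<longrightarrow> e * f = 0) \<and> \<Sum>E = 1"

definition has_gSP_factorization :: "'a::comm_ring_1 poly \<Rightarrow> bool" where
  "has_gSP_factorization h \<longleftrightarrow> (\<exists>E. complete_orthogonal_idempotents E \<and>
    (\<forall>e\<in>E. \<exists>h0 p0. SP_factorization e (Polynomial.smult e h) h0 p0))"

lemma corner_ring_cring:
  fixes e :: "'a::comm_ring_1"
  assumes e: "e * e = e"
  shows "cring (corner_ring e)"
proof -
  have ee: "e * (e * x) = e * x" for x using e by (metis mult.assoc)
  show ?thesis
  proof (intro cringI abelian_groupI comm_monoidI)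
    fix x assume "x \<in> carrier (corner_ring e)"
    then obtain a where a: "x = e * a" by (auto simp: corner_ring_def)
    then have "e * (- a) \<in> carrier (corner_ring e) \<and> e * (- a) + x = 0"
      by (simp add: corner_ring_def del: mult_minus_right) simp
    then show "\<exists>y\<in>carrier (corner_ring e). y \<oplus>\<^bsub>corner_ring e\<^esub> x = \<zero>\<^bsub>corner_ring e\<^esub>"
      by (auto simp: corner_ring_def simp del: mult_minus_right)
  next
    fix x y assume "x \<in> carrier (corner_ring e)" "y \<in> carrier (corner_ring e)"
    then obtain a b where "x = e * a" "y = e * b" by (auto simp: corner_ring_def)
    then have "x + y = e * (a + b)" by (simp add: algebra_simps)
    then show "x \<oplus>\<^bsub>corner_ring e\<^esub> y \<in> carrier (corner_ring e)"
      by (simp add: corner_ring_def)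
  next
    fix x y assume "x \<in> carrier (corner_ring e)" "y \<in> carrier (corner_ring e)"
    then obtain a b where "x = e * a" "y = e * b" by (auto simp: corner_ring_def)
    then have "x * y = e * (a * (e * b))" by (simp add: algebra_simps)
    then show "x \<otimes>\<^bsub>corner_ring e\<^esub> y \<in> carrier (corner_ring e)"
      by (simp add: corner_ring_def)
  next
    show "\<zero>\<^bsub>corner_ring e\<^esub> \<in> carrier (corner_ring e)"
      by (auto simp: corner_ring_def intro: image_eqI[of _ _ 0])
    show "\<one>\<^bsub>corner_ring e\<^esub> \<in> carrier (corner_ring e)"
      by (auto simp: corner_ring_def intro: image_eqI[of _ _ 1])
  qed (auto simp: corner_ring_def algebra_simps e ee)
qed

lemma SP_factorization_1:
  fixes f :: "'a::comm_ring_1 poly"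
  shows "SP_factorization 1 f h0 p0 \<longleftrightarrow> f = h0 * p0 \<and> poly h0 0 dvd 1 \<and>
    (\<forall>i. \<exists>k. coeff (p0 - monom 1 (degree p0)) i ^ k = 0)"
proof -
  have pow: "x [^]\<^bsub>corner_ring (1::'a)\<^esub> k = x ^ k" for x and k :: nat
    by (induction k) (simp_all add: nat_pow_def corner_ring_def mult.commute)
  have car: "carrier (corner_ring (1::'a)) = UNIV"
    by (auto simp: corner_ring_def)
  have un: "x \<in> Units (corner_ring (1::'a)) \<longleftrightarrow> x dvd 1" for x
    by (auto simp: Units_def corner_ring_def dvd_def mult.commute)
  have ze: "\<zero>\<^bsub>corner_ring (1::'a)\<^esub> = 0" by (simp add: corner_ring_def)
  show ?thesis
    by (simp add: SP_factorization_def polys_over_def nil_radical_def pow car un ze)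
qed

end

theory Submission
  imports Defs
begin

text \<open>The link between matrices and factorizations is the Fitting decomposition: a matrix \<open>A\<close> is strongly
  pi-regular exactly if the free module splits into a part on which \<open>A\<close> is invertible and a part on which \<open>A\<close> is
  nilpotent. The characteristic polynomial is the product of those of the two parts, an invertible part contributes a
  factor with invertible constant term, and a nilpotent part of rank \<open>d\<close> contributes \<open>t\<^sup>d\<close> up to nilpotent
  coefficients. The rank of the second part need not be constant, which is why the factorization is only
  obtained after decomposing the ring by idempotents.

  From a strongly pi-regular matrix to a factorization, the decomposition is given by a spectral
  idempotent \<open>E\<close> (\<open>strongly_pi_regular_spectral_idempotent\<close>), and the two factors are determinants built from \<open>E\<close>.
  The idempotents of \<open>R\<close> are the coefficients of \<open>det (t E + F)\<close>, \<open>F = 1 - E\<close>: multiplicativity of the determinant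
  forces them to be orthogonal (\<open>rank_poly_coeff_mult\<close>). That the second factor is a power of \<open>t\<close> up to nilpotents
  reduces to the characteristic polynomial of a nilpotent matrix, which divides a power of \<open>t\<close>
  (\<open>char_poly_dvd_monom\<close>), and to the fact that a monic divisor of a power of \<open>t\<close> has nilpotent lower coefficients
  (\<open>monic_dvd_monom_nilpotent\<close>).

  Conversely, a factorization of \<open>h\<close> yields a relation \<open>t\<^sup>K \<equiv> t\<^bsup>K+1\<^esup> q\<close> modulo \<open>h\<close> in \<open>R[t]\<close>
  (\<open>gSP_factorization_power_relation\<close>). By the Cayley-Hamilton theorem it can be evaluated at any
  matrix with characteristic polynomial \<open>h\<close> and makes both chains of ideals stationary. So strong
  pi-regularity of \<open>A\<close> depends only on the characteristic polynomial, and the equivalence of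
  the universal and the existential statement amounts to the existence of a matrix with characteristic polynomial
  \<open>h\<close>, the companion matrix.\<close>

section \<open>Nilpotent elements\<close>

lemma nilpotent_add:
  fixes x y :: "'a::comm_ring_1"
  assumes "x ^ k = 0" "y ^ m = 0"
  shows "(x + y) ^ (k + m) = 0"
proof -
  have "of_nat (k + m choose i) * x ^ i * y ^ (k + m - i) = 0" if "i \<le> k + m" for i
  proof (cases "k \<le> i")
    case True
    then have "x ^ i = x ^ k * x ^ (i - k)" by (simp flip: power_add)
    then show ?thesis using assms by simp
  next
    case False
    then have "y ^ (k + m - i) = y ^ m * y ^ (k - i)" by (simp add: add.commute flip: power_add)
    then show ?thesis using assms by simp
  qed
  then show ?thesis unfolding binomial_ring by simp
qed

lemma nilpotent_poly:
  fixes p :: "'a::comm_ring_1 poly"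
  assumes "\<forall>i. \<exists>k. coeff p i ^ k = 0"
  shows "\<exists>k. p ^ k = 0"
  using assms
proof (induction p)
  case 0
  show ?case by (rule exI[of _ 1]) simp
next
  case (pCons a p)
  have "\<exists>k. a ^ k = 0" using pCons.prems[rule_format, of 0] by simp
  then obtain k where k: "a ^ k = 0" by blast
  have "\<exists>m. coeff p i ^ m = 0" for i using pCons.prems[rule_format, of "Suc i"] by simp
  then obtain m where m: "p ^ m = 0" using pCons.IH by blast
  have "([:a:] + monom 1 1 * p) ^ (k + m) = 0"
    by (intro nilpotent_add) (simp_all add: poly_const_pow k m power_mult_distrib)
  moreover have "pCons a p = [:a:] + monom 1 1 * p" by (simp add: monom_altdef)
  ultimately show ?case by metis
qed

section \<open>Factors of a power of the variable\<close>

text \<open>Write \<open>a\<close> for the constant term of \<open>f\<close> and \<open>b\<^sub>r\<close> for the coefficients of the cofactor \<open>g\<close>. Comparing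
  coefficients below degree \<open>K\<close> gives \<open>a b\<^sub>0 = 0\<close>, then \<open>a\<^sup>2 b\<^sub>1 = 0\<close>, and so on. As \<open>f\<close> is monic and not
  constant, \<open>g\<close> has degree below \<open>K\<close>, so a power of \<open>a\<close> kills all of \<open>g\<close>, hence the product, whose
  leading coefficient is \<open>1\<close>.\<close>

lemma constant_term_nilpotent:
  fixes f g :: "'a::comm_ring_1 poly"
  assumes f: "monic f" and deg: "degree f > 0" and fg: "f * g = monom 1 K"
  shows "coeff f 0 ^ K = 0"
proof -
  define a where "a = coeff f 0"
  \<comment> \<open>In the coefficient of degree \<open>r\<close> of the product, \<open>a ^ r\<close> kills every term except the first.\<close>
  have lower: "a ^ Suc r * coeff g r = 0" if "r < K" for r
    using that
  proof (induction r rule: less_induct)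
    case (less r)
    have "0 = a ^ r * coeff (f * g) r" using less.prems by (simp add: fg)
    also have "\<dots> = (\<Sum>i\<le>r. a ^ r * (coeff f i * coeff g (r - i)))"
      by (simp add: coeff_mult sum_distrib_left)
    also have "\<dots> = (\<Sum>i\<in>{0}. a ^ r * (coeff f i * coeff g (r - i)))"
    proof (rule sum.mono_neutral_right)
      show "\<forall>i\<in>{..r} - {0}. a ^ r * (coeff f i * coeff g (r - i)) = 0"
      proof
        fix i assume i: "i \<in> {..r} - {0}"
        then have "a ^ Suc (r - i) * coeff g (r - i) = 0" using less by simp
        moreover from i have "a ^ r = a ^ (i - 1) * a ^ Suc (r - i)"
          by (subst power_add[symmetric]) simp
        ultimately have "a ^ r * (coeff f i * coeff g (r - i))
          = (a ^ (i - 1) * coeff f i) * (a ^ Suc (r - i) * coeff g (r - i))"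
          by (simp only: ac_simps)
        then show "a ^ r * (coeff f i * coeff g (r - i)) = 0"
          using \<open>a ^ Suc (r - i) * coeff g (r - i) = 0\<close> by (simp only: mult_zero_right)
      qed
    qed auto
    finally show ?case by (simp add: a_def mult_ac)
  qed
  have "g \<noteq> 0" using fg by (metis mult_zero_right monom_eq_0_iff zero_neq_one)
  then have "degree (f * g) = degree f + degree g" using f by (simp add: degree_monic_mult)
  then have dg: "degree g < K" using deg by (simp add: fg degree_monom_eq)
  have "Polynomial.smult (a ^ K) g = 0"
  proof (rule poly_eqI)
    fix r
    show "coeff (Polynomial.smult (a ^ K) g) r = coeff 0 r"
    proof (cases "r < K")
      case True
      then have "a ^ K = a ^ (K - Suc r) * a ^ Suc r" by (subst power_add[symmetric]) simp
      then show ?thesis using lower[OF True] by (simp only: coeff_smult mult.assoc) simp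
    qed (use dg in \<open>simp add: coeff_eq_0\<close>)
  qed
  then have "Polynomial.smult (a ^ K) (f * g) = 0" by (metis mult_smult_right mult_zero_right)
  then show ?thesis by (simp add: fg smult_monom a_def)
qed

text \<open>Modulo a prime ideal this is the fact that the monic divisors of a power of \<open>t\<close> are powers of \<open>t\<close>.
  The proof avoids prime ideals by removing the constant term \<open>a\<close>: write \<open>f = a + t f'\<close> and
  \<open>f g = t\<^sup>K\<close>. Then \<open>t f' g = f g - a g\<close> divides \<open>(f g)\<^sup>K - (a g)\<^sup>K\<close>, which is a power of \<open>t\<close> because \<open>a\<^sup>K = 0\<close>. So
  \<open>f'\<close> again divides a power of \<open>t\<close>.\<close>

lemma monic_dvd_monom_nilpotent:
  fixes f :: "'a::comm_ring_1 poly"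
  assumes "monic f" "f dvd monom 1 K" "i < degree f"
  shows "\<exists>k. coeff f i ^ k = 0"
  using assms
proof (induction "degree f" arbitrary: f K i)
  case (Suc n)
  obtain a f' where f: "f = pCons a f'" by (cases f)
  with Suc.hyps Suc.prems have f': "f' \<noteq> 0" "degree f' = n" "monic f'" by (auto split: if_splits)
  from Suc.prems obtain g where fg: "f * g = monom 1 K" unfolding dvd_def by metis
  have aK: "a ^ K = 0" using constant_term_nilpotent[OF Suc.prems(1) _ fg] Suc.hyps f by simp
  show ?case
  proof (cases i)
    case 0
    then show ?thesis using aK f by auto
  next
    case (Suc j)
    define x where "x = monom 1 1 * f' * g"
    define y where "y = Polynomial.smult a g"
    have xy: "x + y = monom 1 K" unfolding x_def y_def fg[symmetric] f by (simp add: monom_altdef)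
    have "x dvd (x + y) ^ K - y ^ K"
      using power_diff_sumr2[of "x + y" K y] by simp
    moreover have "y ^ K = 0" unfolding y_def by (simp add: smult_power aK)
    ultimately have "x dvd monom 1 K ^ K" by (simp add: xy)
    then have "x dvd monom 1 (K * K)" by (simp add: monom_power)
    then obtain w where w: "x * w = monom 1 (K * K)" unfolding dvd_def by metis
    \<comment> \<open>One factor of the variable is cancelled below, so the exponent must be positive.\<close>
    have "K * K > 0"
    proof (rule ccontr)
      assume "\<not> K * K > 0"
      then have "coeff (x * w) 0 = 1" by (simp add: w)
      then show False unfolding x_def by (simp add: coeff_mult monom_altdef)
    qed
    then have "monom (1::'a) (K * K) = monom 1 1 * monom 1 (K * K - 1)"
      by (simp add: mult_monom)
    then have "monom 1 1 * (f' * (g * w)) = monom 1 1 * monom (1::'a) (K * K - 1)"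
      using w by (simp add: x_def mult_ac)
    then have "f' * (g * w) = monom 1 (K * K - 1)" by (simp add: monom_altdef)
    then have "f' dvd monom 1 (K * K - 1)" by (metis dvd_triv_left)
    moreover have "j < degree f'" using Suc.prems Suc f f' by simp
    ultimately show ?thesis using Suc.hyps(1)[of f'] f f' Suc by simp
  qed
qed simp

section \<open>Strongly pi-regular elements\<close>

text \<open>In an arbitrary ring, the stabilization of both chains for \<open>r\<close> means that some power of \<open>r\<close> is a right
  and a left multiple of the next power.\<close>

context ring
begin

lemma power_eq_right_multiple:
  assumes "r \<in> carrier R" "x \<in> carrier R" "r [^] (m::nat) = r [^] Suc m \<otimes> x" "m \<le> k"
  shows "r [^] k = r [^] Suc k \<otimes> x"
proof -
  have "r [^] k = r [^] (k - m) \<otimes> r [^] m" using assms by (simp add: nat_pow_mult)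
  also have "\<dots> = (r [^] (k - m) \<otimes> r [^] Suc m) \<otimes> x"
    using assms by (simp only: m_assoc nat_pow_closed)
  also have "r [^] (k - m) \<otimes> r [^] Suc m = r [^] Suc k"
    using assms by (simp only: nat_pow_mult) simp
  finally show ?thesis .
qed

lemma power_eq_left_multiple:
  assumes "r \<in> carrier R" "y \<in> carrier R" "r [^] (m::nat) = y \<otimes> r [^] Suc m" "m \<le> k"
  shows "r [^] k = y \<otimes> r [^] Suc k"
proof -
  have "r [^] k = r [^] m \<otimes> r [^] (k - m)" using assms by (simp add: nat_pow_mult)
  also have "\<dots> = y \<otimes> (r [^] Suc m \<otimes> r [^] (k - m))"
    using assms by (simp only: m_assoc nat_pow_closed)
  also have "r [^] Suc m \<otimes> r [^] (k - m) = r [^] Suc k"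
    using assms by (simp only: nat_pow_mult) simp
  finally show ?thesis .
qed

lemma strongly_pi_regularI:
  assumes r: "r \<in> carrier R" and x: "x \<in> carrier R" and y: "y \<in> carrier R"
    and right: "r [^] (m::nat) = r [^] Suc m \<otimes> x" and left: "r [^] m = y \<otimes> r [^] Suc m"
  shows "strongly_pi_regular R r"
proof -
  have R: "(r [^] k) <# carrier R = (r [^] Suc m) <# carrier R" if "Suc m \<le> k" for k
    using that
  proof (induction k rule: dec_induct)
    case (step k)
    have eq: "r [^] k = r [^] Suc k \<otimes> x"
      using power_eq_right_multiple[OF r x right, of k] step by simp
    have "(r [^] Suc k) <# carrier R = (r [^] k) <# carrier R"
    proof
      show "(r [^] k) <# carrier R \<subseteq> (r [^] Suc k) <# carrier R"
      proof
        fix a assume "a \<in> (r [^] k) <# carrier R"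
        then obtain s where s: "s \<in> carrier R" "a = r [^] k \<otimes> s" by (auto simp: l_coset_def)
        then have "a = r [^] Suc k \<otimes> (x \<otimes> s)"
          using eq r x by (metis m_assoc nat_pow_closed)
        then show "a \<in> (r [^] Suc k) <# carrier R" using s x unfolding l_coset_def by blast
      qed
      show "(r [^] Suc k) <# carrier R \<subseteq> (r [^] k) <# carrier R"
      proof
        fix a assume "a \<in> (r [^] Suc k) <# carrier R"
        then obtain s where s: "s \<in> carrier R" "a = r [^] Suc k \<otimes> s" by (auto simp: l_coset_def)
        then have "a = r [^] k \<otimes> (r \<otimes> s)" using r by (simp add: m_assoc)
        then show "a \<in> (r [^] k) <# carrier R" using s r unfolding l_coset_def by blast
      qed
    qed
    then show ?case using step.IH by simp
  qed simp
  have L: "carrier R #> (r [^] k) = carrier R #> (r [^] Suc m)" if "Suc m \<le> k" for k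
    using that
  proof (induction k rule: dec_induct)
    case (step k)
    have eq: "r [^] k = y \<otimes> r [^] Suc k"
      using power_eq_left_multiple[OF r y left, of k] step by simp
    have "carrier R #> (r [^] Suc k) = carrier R #> (r [^] k)"
    proof
      show "carrier R #> (r [^] k) \<subseteq> carrier R #> (r [^] Suc k)"
      proof
        fix a assume "a \<in> carrier R #> (r [^] k)"
        then obtain s where s: "s \<in> carrier R" "a = s \<otimes> r [^] k" by (auto simp: r_coset_def)
        then have "a = (s \<otimes> y) \<otimes> r [^] Suc k"
          using eq r y by (metis m_assoc nat_pow_closed)
        then show "a \<in> carrier R #> (r [^] Suc k)" using s y unfolding r_coset_def by blast
      qed
      show "carrier R #> (r [^] Suc k) \<subseteq> carrier R #> (r [^] k)"
      proof
        fix a assume "a \<in> carrier R #> (r [^] Suc k)"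
        then obtain s where s: "s \<in> carrier R" "a = s \<otimes> r [^] Suc k" by (auto simp: r_coset_def)
        then have "a = (s \<otimes> r) \<otimes> r [^] k"
          using r by (metis m_assoc nat_pow_Suc2 nat_pow_closed)
        then show "a \<in> carrier R #> (r [^] k)" using s r unfolding r_coset_def by blast
      qed
    qed
    then show ?case using step.IH by simp
  qed simp
  show ?thesis unfolding strongly_pi_regular_def
    using r R L by (metis Suc_le_mono le0 One_nat_def)
qed

text \<open>This is the Fitting decomposition in terms of elements. Stabilization gives a power \<open>b\<close> of \<open>r\<close> with
  \<open>b = b\<^sup>2 x = y b\<^sup>2\<close>; then \<open>b x = y b\<close> is an idempotent \<open>e\<close>. Expressing \<open>e\<close> in both ways shows that it commutes
  with \<open>r\<close>. The element \<open>r\<close> is invertible on the \<open>e\<close> part, with right inverse \<open>z\<close>, and nilpotent on the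
  complementary part because \<open>b\<close> vanishes there.\<close>

lemma strongly_pi_regular_spectral_idempotent:
  assumes "strongly_pi_regular R r"
  obtains e z and m :: nat where "e \<in> carrier R" "z \<in> carrier R" "e \<otimes> e = e" "r \<otimes> e = e \<otimes> r"
    "e \<otimes> r \<otimes> z = e" "r [^] m \<otimes> e = r [^] m" "1 \<le> m"
proof -
  have r: "r \<in> carrier R" using assms by (simp add: strongly_pi_regular_def)
  obtain m1 m2 where "m1 \<ge> 1"
    and m1: "\<And>k. k \<ge> m1 \<Longrightarrow> (r [^] k) <# carrier R = (r [^] (m1::nat)) <# carrier R"
    and m2: "\<And>k. k \<ge> m2 \<Longrightarrow> carrier R #> (r [^] k) = carrier R #> (r [^] (m2::nat))"
    using assms unfolding strongly_pi_regular_def by blast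
  define m where "m = max m1 m2"
  have "1 \<le> m" using \<open>m1 \<ge> 1\<close> by (simp add: m_def)
  define b where "b = r [^] m"
  have b: "b \<in> carrier R" using r by (simp add: b_def)
  have bb: "r [^] (m + m) = b \<otimes> b" using r by (simp add: b_def nat_pow_mult)
  have "(r [^] m) <# carrier R = (r [^] (m + m)) <# carrier R"
    using m1[of m] m1[of "m + m"] by (simp add: m_def)
  moreover have "b \<otimes> \<one> \<in> (r [^] m) <# carrier R" unfolding l_coset_def b_def by blast
  ultimately obtain x where x: "x \<in> carrier R" "b = b \<otimes> b \<otimes> x"
    using b by (auto simp: l_coset_def bb)
  have "carrier R #> (r [^] m) = carrier R #> (r [^] (m + m))"
    using m2[of m] m2[of "m + m"] by (simp add: m_def)
  moreover have "\<one> \<otimes> b \<in> carrier R #> (r [^] m)" unfolding r_coset_def b_def by blast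
  ultimately obtain y where y: "y \<in> carrier R" "b = y \<otimes> (b \<otimes> b)"
    using b by (auto simp: r_coset_def bb)
  define e where "e = b \<otimes> x"
  have e: "e \<in> carrier R" using b x by (simp add: e_def)
  have e': "e = y \<otimes> b"
    using b x y unfolding e_def by (metis m_assoc m_closed)
  have be: "b \<otimes> e = b" using b x unfolding e_def by (metis m_assoc)
  have eb: "e \<otimes> b = b" using b y e' by (metis m_assoc)
  have ee: "e \<otimes> e = e" using b x eb e unfolding e_def by (metis m_assoc)
  have rb: "r \<otimes> b = b \<otimes> r" using r unfolding b_def by (metis nat_pow_Suc nat_pow_Suc2)
  have "r \<otimes> e = (r \<otimes> b) \<otimes> x" unfolding e_def using r b x by (simp add: m_assoc)
  also have "\<dots> = b \<otimes> (r \<otimes> x)" unfolding rb using r b x by (simp add: m_assoc)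
  finally have re: "r \<otimes> e = b \<otimes> (r \<otimes> x)" .
  have ere: "e \<otimes> (r \<otimes> e) = r \<otimes> e"
    unfolding re using m_assoc[OF e b, of "r \<otimes> x"] r x by (simp add: eb)
  have "e \<otimes> r = y \<otimes> (b \<otimes> r)" unfolding e' using r b y by (simp add: m_assoc)
  also have "\<dots> = (y \<otimes> r) \<otimes> b" unfolding rb[symmetric] using r b y by (simp add: m_assoc)
  finally have er: "e \<otimes> r = (y \<otimes> r) \<otimes> b" .
  have "(e \<otimes> r) \<otimes> e = e \<otimes> r"
    unfolding er using m_assoc[OF _ b e, of "y \<otimes> r"] r y(1) by (simp add: be)
  with ere have comm: "r \<otimes> e = e \<otimes> r" using r e by (simp add: m_assoc)
  have rr: "r \<otimes> r [^] (m - 1) = b" using r \<open>1 \<le> m\<close> nat_pow_Suc2[OF r, of "m - 1"]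
    by (simp add: b_def)
  have "e \<otimes> r \<otimes> (r [^] (m - 1) \<otimes> x) = e \<otimes> ((r \<otimes> r [^] (m - 1)) \<otimes> x)"
    using r e x by (simp add: m_assoc)
  also have "\<dots> = e" unfolding rr e_def[symmetric] by (rule ee)
  finally have "e \<otimes> r \<otimes> (r [^] (m - 1) \<otimes> x) = e" .
  moreover have "r [^] (m - 1) \<otimes> x \<in> carrier R" using r x by simp
  ultimately show thesis using that e ee comm be \<open>1 \<le> m\<close> unfolding b_def by blast
qed

end

section \<open>Evaluating polynomials at matrices\<close>

text \<open>The Horner scheme is used because the zero matrix depends on the size: the recursion takes it as its start value,
  whereas an empty sum of matrices has no size of its own.\<close>

definition mat_poly :: "'a::comm_ring_1 poly \<Rightarrow> 'a mat \<Rightarrow> 'a mat" where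
  "mat_poly p A = fold_coeffs (\<lambda>a M. a \<cdot>\<^sub>m 1\<^sub>m (dim_row A) + A * M) p (0\<^sub>m (dim_row A) (dim_row A))"

context
  fixes n :: nat and A :: "'a::comm_ring_1 mat"
  assumes A: "A \<in> carrier_mat n n"
begin

lemma mat_poly_0: "mat_poly 0 A = 0\<^sub>m n n"
  using A by (simp add: mat_poly_def)

lemma mat_poly_pCons: "mat_poly (pCons a p) A = a \<cdot>\<^sub>m 1\<^sub>m n + A * mat_poly p A"
proof (cases "a = 0 \<and> p = 0")
  case True
  then show ?thesis using A by (auto simp: mat_poly_def)
next
  case False
  then show ?thesis using A by (auto simp: mat_poly_def)
qed

lemma mat_poly_carrier [simp]: "mat_poly p A \<in> carrier_mat n n"
  by (induction p) (use A in \<open>simp_all add: mat_poly_0 mat_poly_pCons\<close>)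

lemma mat_poly_dim [simp]: "dim_row (mat_poly p A) = n" "dim_col (mat_poly p A) = n"
  using carrier_matD[OF mat_poly_carrier[of p]] .

lemma mat_poly_add: "mat_poly (p + q) A = mat_poly p A + mat_poly q A"
proof (induction p q rule: poly_induct2)
  case (pCons a p b q)
  have "mat_poly (pCons a p + pCons b q) A
    = (a + b) \<cdot>\<^sub>m 1\<^sub>m n + A * (mat_poly p A + mat_poly q A)"
    by (simp add: mat_poly_pCons pCons)
  also have "A * (mat_poly p A + mat_poly q A) = A * mat_poly p A + A * mat_poly q A"
    by (rule mult_add_distrib_mat[OF A, of _ n]) simp_all
  also have "(a + b) \<cdot>\<^sub>m 1\<^sub>m n + \<dots>
    = (a \<cdot>\<^sub>m 1\<^sub>m n + A * mat_poly p A) + (b \<cdot>\<^sub>m 1\<^sub>m n + A * mat_poly q A)"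
    by (rule eq_matI) (use A in \<open>auto simp: distrib_right distrib_left mult.assoc simp del: index_mult_mat(1)\<close>)
  finally show ?case by (simp add: mat_poly_pCons)
qed (simp add: mat_poly_0)

lemma mat_poly_smult: "mat_poly (Polynomial.smult c p) A = c \<cdot>\<^sub>m mat_poly p A"
proof (induction p)
  case (pCons a p)
  have "mat_poly (Polynomial.smult c (pCons a p)) A = (c * a) \<cdot>\<^sub>m 1\<^sub>m n + A * (c \<cdot>\<^sub>m mat_poly p A)"
    by (simp add: mat_poly_pCons pCons)
  also have "A * (c \<cdot>\<^sub>m mat_poly p A) = c \<cdot>\<^sub>m (A * mat_poly p A)"
    by (rule mult_smult_distrib[OF A, of _ n]) simp
  also have "(c * a) \<cdot>\<^sub>m 1\<^sub>m n + \<dots> = c \<cdot>\<^sub>m (a \<cdot>\<^sub>m 1\<^sub>m n + A * mat_poly p A)"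
    by (rule eq_matI) (use A in \<open>auto simp: distrib_right distrib_left mult.assoc simp del: index_mult_mat(1)\<close>)
  finally show ?case by (simp add: mat_poly_pCons)
qed (simp add: mat_poly_0)

lemma mat_poly_mult: "mat_poly (p * q) A = mat_poly p A * mat_poly q A"
proof (induction p)
  case 0
  show ?case by (simp add: mat_poly_0 left_mult_zero_mat[OF mat_poly_carrier])
next
  case (pCons a p)
  have "mat_poly (pCons a p * q) A = a \<cdot>\<^sub>m mat_poly q A + (0 \<cdot>\<^sub>m 1\<^sub>m n + A * mat_poly (p * q) A)"
    by (simp only: mult_pCons_left mat_poly_add mat_poly_smult mat_poly_pCons)
  also have "0 \<cdot>\<^sub>m 1\<^sub>m n + A * mat_poly (p * q) A = (A * mat_poly p A) * mat_poly q A"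
  proof -
    have "0 \<cdot>\<^sub>m 1\<^sub>m n = (0\<^sub>m n n :: 'a mat)" by auto
    moreover have "A * (mat_poly p A * mat_poly q A) \<in> carrier_mat n n"
      by (rule mult_carrier_mat[OF A mult_carrier_mat[OF mat_poly_carrier mat_poly_carrier]])
    ultimately show ?thesis
      by (simp add: pCons left_add_zero_mat assoc_mult_mat[OF A mat_poly_carrier mat_poly_carrier])
  qed
  also have "a \<cdot>\<^sub>m mat_poly q A = (a \<cdot>\<^sub>m 1\<^sub>m n) * mat_poly q A"
    by (subst mult_smult_assoc_mat[of _ n n _ n]) simp_all
  also have "\<dots> + A * mat_poly p A * mat_poly q A = (a \<cdot>\<^sub>m 1\<^sub>m n + A * mat_poly p A) * mat_poly q A"
    by (rule add_mult_distrib_mat[symmetric, of _ n n _ _ n]) (use A in simp_all)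
  finally show ?case by (simp add: mat_poly_pCons)
qed

lemma mat_poly_monom: "mat_poly (monom 1 k) A = A ^\<^sub>m k"
proof (induction k)
  case 0
  show ?case using A by (auto simp: monom_0 mat_poly_pCons mat_poly_0 intro!: eq_matI)
next
  case (Suc k)
  have "mat_poly (monom 1 (Suc k)) A = mat_poly (monom 1 k * monom 1 1) A" by (simp add: mult_monom)
  also have "\<dots> = A ^\<^sub>m k * mat_poly (monom 1 1) A" unfolding mat_poly_mult Suc ..
  also have "mat_poly (monom 1 1) A = A"
    using A by (auto simp: monom_altdef mat_poly_pCons mat_poly_0)
  finally show ?case by simp
qed

text \<open>Let \<open>B\<close> be the adjugate of \<open>t - A\<close>, with matrix coefficients \<open>B\<^sub>k\<close>, and let \<open>h\<close> be the characteristic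
  polynomial with coefficients \<open>h\<^sub>k\<close>. Comparing coefficients in \<open>B (t - A) = h\<close> gives
  \<open>B\<^sub>k = h\<^bsub>k+1\<^esub> + B\<^bsub>k+1\<^esub> A\<close> and \<open>0 = h\<^sub>0 + B\<^sub>0 A\<close>. This is the Horner recursion that computes \<open>h(A)\<close>, so the
  matrices \<open>B\<^sub>k\<close> are its intermediate results and \<open>0\<close> is the final one.\<close>

lemma Cayley_Hamilton: "mat_poly (char_poly A) A = 0\<^sub>m n n"
proof -
  let ?C = "char_poly_matrix A"
  have C: "?C \<in> carrier_mat n n" using A by simp
  define B where "B = adj_mat ?C"
  have B: "B \<in> carrier_mat n n" unfolding B_def by (rule adj_mat[OF C])
  have BC: "B * ?C = char_poly A \<cdot>\<^sub>m 1\<^sub>m n" unfolding B_def char_poly_def by (rule adj_mat[OF C])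
  define Bk where "Bk k = map_mat (\<lambda>p. coeff p k) B" for k
  have Bk: "Bk k \<in> carrier_mat n n" for k using B by (simp add: Bk_def)
  have dims: "dim_row (Bk k) = n" "dim_col (Bk k) = n" "dim_row A = n" "dim_col A = n" for k
    using Bk[of k] A by auto
  have "B * ?C = [:0, 1:] \<cdot>\<^sub>m B - B * map_mat (\<lambda>a. [:a:]) A"
  proof -
    have m: "map_mat (\<lambda>a. [:a:]) A \<in> carrier_mat n n" using A by simp
    have "?C = [:0, 1:] \<cdot>\<^sub>m 1\<^sub>m n - map_mat (\<lambda>a. [:a:]) A"
      by (rule eq_matI) (use A in \<open>auto simp: char_poly_matrix_def\<close>)
    then have "B * ?C = B * ([:0, 1:] \<cdot>\<^sub>m 1\<^sub>m n) - B * map_mat (\<lambda>a. [:a:]) A"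
      using mult_minus_distrib_mat[OF B _ m, of "[:0, 1:] \<cdot>\<^sub>m 1\<^sub>m n"] by simp
    also have "B * ([:0, 1:] \<cdot>\<^sub>m 1\<^sub>m n) = [:0, 1:] \<cdot>\<^sub>m B"
      using mult_smult_distrib[OF B, of "1\<^sub>m n" n "[:0, 1:]"] B by simp
    finally show ?thesis .
  qed
  then have ent: "(char_poly A \<cdot>\<^sub>m 1\<^sub>m n) $$ (i, j)
    = [:0, 1:] * B $$ (i, j) - (\<Sum>l = 0..<n. B $$ (i, l) * [:A $$ (l, j):])" if "i < n" "j < n" for i j
    using that A B BC by (auto simp: scalar_prod_def)
  have entk: "(coeff (char_poly A) k \<cdot>\<^sub>m 1\<^sub>m n) $$ (i, j)
     = coeff (pCons 0 (B $$ (i, j))) k - (Bk k * A) $$ (i, j)" if ij: "i < n" "j < n" for i j k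
  proof -
    have "(coeff (char_poly A) k \<cdot>\<^sub>m 1\<^sub>m n) $$ (i, j) = coeff ((char_poly A \<cdot>\<^sub>m 1\<^sub>m n) $$ (i, j)) k"
      using ij by simp
    also have "\<dots> = coeff (pCons 0 (B $$ (i, j))) k - (Bk k * A) $$ (i, j)"
      unfolding ent[OF ij] using ij A B
      by (simp add: coeff_sum Bk_def scalar_prod_def mult.commute)
    finally show ?thesis .
  qed
  have coeffs: "coeff (char_poly A) (Suc k) \<cdot>\<^sub>m 1\<^sub>m n + Bk (Suc k) * A = Bk k" for k
  proof (rule eq_matI)
    fix i j assume "i < dim_row (Bk k)" "j < dim_col (Bk k)"
    then have ij: "i < n" "j < n" using Bk[of k] by auto
    from entk[OF this, of "Suc k"] have "(coeff (char_poly A) (Suc k) \<cdot>\<^sub>m 1\<^sub>m n) $$ (i, j)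
      + (Bk (Suc k) * A) $$ (i, j) = Bk k $$ (i, j)"
      using ij B unfolding Bk_def by simp
    then show "(coeff (char_poly A) (Suc k) \<cdot>\<^sub>m 1\<^sub>m n + Bk (Suc k) * A) $$ (i, j) = Bk k $$ (i, j)"
      using ij by (simp add: dims del: index_mult_mat(1))
  qed (simp_all add: dims)
  have base: "coeff (char_poly A) 0 \<cdot>\<^sub>m 1\<^sub>m n + Bk 0 * A = 0\<^sub>m n n"
  proof (rule eq_matI)
    fix i j assume "i < dim_row (0\<^sub>m n n)" "j < dim_col (0\<^sub>m n n)"
    then have ij: "i < n" "j < n" by auto
    from entk[OF this, of 0] have "(coeff (char_poly A) 0 \<cdot>\<^sub>m 1\<^sub>m n) $$ (i, j)
      + (Bk 0 * A) $$ (i, j) = 0"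
      using ij B unfolding Bk_def by simp
    then show "(coeff (char_poly A) 0 \<cdot>\<^sub>m 1\<^sub>m n + Bk 0 * A) $$ (i, j) = 0\<^sub>m n n $$ (i, j)"
      using ij by (simp add: dims del: index_mult_mat(1))
  qed (use A Bk in auto)
  have commute: "A * mat_poly p A = mat_poly p A * A" for p
  proof -
    have "mat_poly (monom 1 1 * p) A = mat_poly (p * monom 1 1) A" by (simp add: mult.commute)
    then show ?thesis unfolding mat_poly_mult mat_poly_monom using A by simp
  qed
  have horner: "mat_poly (poly_shift k p) A
     = coeff p k \<cdot>\<^sub>m 1\<^sub>m n + mat_poly (poly_shift (Suc k) p) A * A" for k p
  proof -
    have "poly_shift k p = pCons (coeff p k) (poly_shift (Suc k) p)"
      by (rule poly_eqI) (simp add: coeff_poly_shift coeff_pCons split: nat.split)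
    then show ?thesis by (simp add: mat_poly_pCons commute)
  qed
  \<comment> \<open>Downward induction, starting where both the shifted polynomial and the coefficient of \<open>B\<close> vanish.\<close>
  have tails: "mat_poly (poly_shift (Suc k) (char_poly A)) A = Bk k" for k
  proof -
    define D where "D = Max (insert (degree (char_poly A)) {degree (B $$ (i, j)) |i j. i < n \<and> j < n})"
    have fin: "finite {degree (B $$ (i, j)) |i j. i < n \<and> j < n}"
      by (rule finite_subset[of _ "(\<lambda>(i, j). degree (B $$ (i, j))) ` ({..<n} \<times> {..<n})"]) auto
    have large: "mat_poly (poly_shift (Suc k) (char_poly A)) A = Bk k" if "k > D" for k
    proof -
      have "degree (char_poly A) \<le> D" unfolding D_def using fin by (intro Max_ge) auto
      then have "poly_shift (Suc k) (char_poly A) = 0"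
        using that by (intro poly_eqI) (simp add: coeff_poly_shift coeff_eq_0)
      moreover have "degree (B $$ (i, j)) \<le> D" if "i < n" "j < n" for i j
        unfolding D_def using fin that by (intro Max_ge) auto
      then have "Bk k = 0\<^sub>m n n"
        using that B by (intro eq_matI) (auto simp: Bk_def intro!: coeff_eq_0 le_less_trans[of _ D])
      ultimately show ?thesis by (simp add: mat_poly_0)
    qed
    show ?thesis
    proof (cases "k > D")
      case False
      then have "k \<le> Suc D" by simp
      then show ?thesis
      proof (induction k rule: inc_induct)
        case base
        then show ?case by (intro large) simp
      next
        case (step k)
        show ?case unfolding horner[of "Suc k"] step.IH by (rule coeffs)
      qed
    qed (rule large)
  qed
  have "mat_poly (char_poly A) A = mat_poly (poly_shift 0 (char_poly A)) A" by simp
  also have "\<dots> = 0\<^sub>m n n" unfolding horner[of 0] using tails[of 0] base by simp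
  finally show ?thesis .
qed

end

section \<open>Companion matrices\<close>

text \<open>This is \<open>t - C\<close> for the companion matrix \<open>C\<close> of \<open>h\<close> with \<open>1\<close> above the diagonal and the negated coefficients of \<open>h\<close>
  in the last row. The three contributions are added because the diagonal and the last row overlap.\<close>

definition companion_char_matrix :: "'a::comm_ring_1 poly \<Rightarrow> nat \<Rightarrow> 'a poly mat" where
  "companion_char_matrix h n = mat n n (\<lambda>(i, j). (if i = j then [:0, 1:] else 0)
     + (if j = Suc i then - 1 else 0) + (if Suc i = n then [:coeff h j:] else 0))"

text \<open>Write \<open>h = a + t p\<close>. Expanding along the first column leaves two minors: the matrix for \<open>p\<close>, with
  entry \<open>t\<close>, and a lower triangular matrix with diagonal \<open>-1\<close>, with entry \<open>a\<close>.\<close>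

lemma det_companion_char_matrix:
  fixes h :: "'a::comm_ring_1 poly"
  assumes "monic h" "degree h = n"
  shows "det (companion_char_matrix h n) = h"
  using assms
proof (induction n arbitrary: h)
  case 0
  then have "h = 1" using monic_degree_0 by blast
  then show ?case by (simp add: companion_char_matrix_def)
next
  case (Suc n)
  obtain a p where h: "h = pCons a p" by (cases h)
  with Suc.prems have p: "p \<noteq> 0" "monic p" "degree p = n" by (auto split: if_splits)
  let ?M = "companion_char_matrix h (Suc n)"
  have M: "?M \<in> carrier_mat (Suc n) (Suc n)" by (simp add: companion_char_matrix_def)
  have lap: "det ?M = (\<Sum>i<Suc n. ?M $$ (i, 0) * cofactor ?M i 0)"
    by (rule laplace_expansion_column[OF M]) simp
  have "mat_delete ?M 0 0 = companion_char_matrix p n"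
    by (rule eq_matI) (auto simp: mat_delete_def companion_char_matrix_def h)
  then have cof0: "cofactor ?M 0 0 = p"
    using Suc.IH[OF p(2,3)] by (simp add: cofactor_def)
  have cofn: "cofactor ?M n 0 = 1"
  proof -
    let ?D = "mat_delete ?M n 0"
    have D: "?D \<in> carrier_mat n n" using mat_delete_carrier[OF M] by simp
    have "det ?D = prod_list (diag_mat ?D)"
      by (rule det_lower_triangular[OF _ D])
        (auto simp: mat_delete_def companion_char_matrix_def)
    also have "diag_mat ?D = replicate n (- 1)"
      by (rule nth_equalityI) (auto simp: diag_mat_def mat_delete_def companion_char_matrix_def)
    finally show ?thesis by (simp add: cofactor_def flip: power_mult_distrib)
  qed
  have "det ?M = [:0, 1:] * p + [:a:]"
  \<comment> \<open>For \<open>n = 0\<close> the two entries of the first column coincide.\<close>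
  proof (cases n)
    case 0
    then have "p = 1" using p monic_degree_0 by blast
    then show ?thesis using cof0 lap 0 h by (simp add: companion_char_matrix_def)
  next
    case (Suc k)
    have "(\<Sum>i<Suc n. ?M $$ (i, 0) * cofactor ?M i 0)
      = (\<Sum>i\<in>{0, n}. ?M $$ (i, 0) * cofactor ?M i 0)"
      by (rule sum.mono_neutral_right) (auto simp: companion_char_matrix_def)
    also have "\<dots> = ?M $$ (0, 0) * p + ?M $$ (n, 0)"
    proof -
      have "0 \<noteq> n" using Suc by simp
      then show ?thesis by (simp add: cof0 cofn)
    qed
    finally show ?thesis unfolding lap using Suc h by (simp add: companion_char_matrix_def)
  qed
  then show ?case by (simp add: h)
qed

lemma companion_matrix_exists:
  fixes h :: "'a::comm_ring_1 poly"
  assumes "monic h" "degree h = n"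
  shows "\<exists>A \<in> carrier_mat n n. char_poly A = h"
proof
  let ?A = "mat n n (\<lambda>(i, j). (if j = Suc i then 1 else 0) - (if Suc i = n then coeff h j else 0))"
  have "char_poly_matrix ?A = companion_char_matrix h n"
    by (rule eq_matI) (auto simp: char_poly_matrix_def companion_char_matrix_def one_pCons)
  then show "char_poly ?A = h"
    by (simp add: char_poly_def det_companion_char_matrix[OF assms])
qed simp

section \<open>SP-factorizations in a corner ring\<close>

lemma polys_over_corner_ring_iff:
  assumes "e * e = e"
  shows "p \<in> polys_over (carrier (corner_ring e)) \<longleftrightarrow> Polynomial.smult e p = p"
proof -
  have "x \<in> range ((*) e) \<longleftrightarrow> e * x = x" for x
    using assms by (metis (no_types, lifting) mult.assoc rangeE rangeI)
  then show ?thesis by (simp add: polys_over_def corner_ring_def poly_eq_iff)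
qed

lemma pow_corner_ring: "x [^]\<^bsub>corner_ring e\<^esub> (k::nat) = e * x ^ k"
  by (induction k) (simp_all add: nat_pow_def corner_ring_def mult_ac)

text \<open>All data of an SP-factorization live in the ambient ring: an inverse in the corner ring can be obtained by
  multiplying any \<open>v\<close> with \<open>h0(0) v = e\<close> by \<open>e\<close>, and an element of the corner is nilpotent there exactly
  if it is nilpotent in the whole ring.\<close>

lemma SP_factorization_iff:
  fixes e :: "'a::comm_ring_1"
  assumes e: "e * e = e"
  shows "SP_factorization e f h0 p0 \<longleftrightarrow> Polynomial.smult e h0 = h0 \<and> Polynomial.smult e p0 = p0
    \<and> f = h0 * p0 \<and> (\<exists>v. poly h0 0 * v = e)
    \<and> (\<forall>i. \<exists>k. coeff (p0 - monom e (degree p0)) i ^ k = 0)"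
proof -
  have unit: "poly h0 0 \<in> Units (corner_ring e) \<longleftrightarrow> (\<exists>v. poly h0 0 * v = e)"
    if "Polynomial.smult e h0 = h0"
  proof
    assume "\<exists>v. poly h0 0 * v = e"
    then obtain v where "poly h0 0 * (e * v) = e" using e by (metis mult.left_commute)
    moreover have "e * v \<in> range ((*) e)" by blast
    moreover have "poly h0 0 \<in> range ((*) e)" using that by (metis poly_smult rangeI)
    ultimately show "poly h0 0 \<in> Units (corner_ring e)"
      unfolding Units_def corner_ring_def by (auto simp: mult.commute[of _ "poly h0 0"])
  qed (auto simp: Units_def corner_ring_def)
  have nil: "(p0 - monom e (degree p0) \<in> polys_over (nil_radical (corner_ring e)))
      \<longleftrightarrow> (\<forall>i. \<exists>k. coeff (p0 - monom e (degree p0)) i ^ k = 0)" if "Polynomial.smult e p0 = p0"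
  proof -
    have fixed: "e * coeff (p0 - monom e (degree p0)) i = coeff (p0 - monom e (degree p0)) i" for i
    proof -
      have "e * coeff p0 i = coeff p0 i" using that by (metis coeff_smult)
      then show ?thesis by (simp add: right_diff_distrib e)
    qed
    have "x \<in> nil_radical (corner_ring e) \<longleftrightarrow> (\<exists>k. x ^ k = 0)" if x: "e * x = x" for x
    proof -
      have "x ^ Suc k = 0" if "e * x ^ k = 0" for k
        using that x by (metis mult.assoc mult.commute mult_zero_right power_Suc)
      moreover have "x \<in> range ((*) e)" using x by (metis rangeI)
      moreover have "x \<in> nil_radical (corner_ring e) \<longleftrightarrow> x \<in> range ((*) e) \<and> (\<exists>k. e * x ^ k = 0)"
        unfolding nil_radical_def pow_corner_ring by (simp add: corner_ring_def)
      ultimately show ?thesis by (metis mult_zero_right)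
    qed
    with fixed show ?thesis by (simp add: polys_over_def)
  qed
  show ?thesis unfolding SP_factorization_def polys_over_corner_ring_iff[OF e]
    using unit nil by blast
qed

text \<open>Modulo \<open>h\<close>, the product \<open>h0 p0\<close> vanishes, and \<open>p0\<close> is \<open>e t\<^sup>d\<close> up to the nilpotent polynomial \<open>\<nu>\<close>. So \<open>e t\<^sup>d h0\<close>
  equals the nilpotent \<open>- \<nu> h0\<close>, and an \<open>m\<close>-th power of it vanishes: \<open>e t\<^bsup>d m\<^esup> h0\<^sup>m = 0\<close>. Since the constant
  term of \<open>h0\<^sup>m\<close> is invertible in the corner ring, this expresses \<open>e t\<^bsup>d m\<^esup>\<close> as a multiple of the next power of
  \<open>t\<close>.\<close>

lemma SP_factorization_power_relation:
  fixes e :: "'a::comm_ring_1"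
  assumes e: "e * e = e" and SP: "SP_factorization e (Polynomial.smult e h) h0 p0"
  shows "\<exists>K q. h dvd Polynomial.smult e (monom 1 K) - monom 1 (Suc K) * q"
proof -
  define d where "d = degree p0"
  define \<nu> where "\<nu> = p0 - monom e d"
  note SP = SP[unfolded SP_factorization_iff[OF e]]
  obtain m where m: "\<nu> ^ m = 0" using nilpotent_poly SP unfolding \<nu>_def d_def by blast
  obtain v where v: "poly h0 0 * v = e" using SP by blast
  have ek: "e * e ^ k = e" for k by (induction k) (simp_all add: e flip: mult.assoc)
  define X where "X = monom e d * h0"
  have "X - - (\<nu> * h0) = Polynomial.smult e h" using SP by (simp add: X_def \<nu>_def algebra_simps)
  moreover have "X - - (\<nu> * h0) dvd X ^ m - (- (\<nu> * h0)) ^ m"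
    by (simp add: power_diff_sumr2)
  moreover have "(- (\<nu> * h0)) ^ m = 0"
    using m by (simp add: power_mult_distrib power_minus[of "\<nu> * h0"])
  moreover have "h dvd Polynomial.smult e h" by (simp add: dvd_smult)
  ultimately have hX: "h dvd X ^ m" by (metis diff_zero dvd_trans)
  obtain w where w: "h0 ^ m = [:poly h0 0 ^ m:] + monom 1 1 * w"
  proof -
    obtain a b where ab: "h0 ^ m = pCons a b" by (cases "h0 ^ m")
    have "a = poly h0 0 ^ m" using arg_cong[OF ab, of "\<lambda>p. poly p 0"] by simp
    with ab have "h0 ^ m = pCons (poly h0 0 ^ m) b" by simp
    then show ?thesis by (intro that[of b]) (simp add: monom_altdef)
  qed
  \<comment> \<open>The factor \<open>e * v ^ m\<close> inverts the constant term of \<open>h0 ^ m\<close> in the corner ring; \<open>e ^ m\<close> comes from \<open>X ^ m\<close>.\<close>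
  define c where "c = e * v ^ m * e ^ m"
  have "c * poly h0 0 ^ m = (e * e ^ m) * (poly h0 0 * v) ^ m"
    unfolding c_def power_mult_distrib by (simp only: ac_simps)
  then have c: "c * poly h0 0 ^ m = e" by (simp only: v ek)
  have Xm: "X ^ m = Polynomial.smult (e ^ m) (monom 1 (d * m) * h0 ^ m)"
    by (simp add: X_def power_mult_distrib monom_power smult_monom flip: mult_smult_left)
  have "Polynomial.smult (e * v ^ m) (X ^ m) = Polynomial.smult c (monom 1 (d * m) * h0 ^ m)"
    by (simp add: Xm c_def)
  also have "\<dots> = Polynomial.smult e (monom 1 (d * m))
      + monom 1 (Suc (d * m)) * Polynomial.smult c w"
  proof -
    have "monom 1 (d * m) * (monom 1 1 * w) = monom 1 (Suc (d * m)) * w"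
      by (simp add: mult_monom mult.assoc[symmetric])
    moreover have "monom 1 (d * m) * [:poly h0 0 ^ m:]
        = Polynomial.smult (poly h0 0 ^ m) (monom 1 (d * m))"
      by simp
    ultimately show ?thesis unfolding w by (simp only: distrib_left smult_add_right smult_smult c mult_smult_right)
  qed
  finally have "h dvd Polynomial.smult e (monom 1 (d * m))
      - monom 1 (Suc (d * m)) * (- Polynomial.smult c w)"
    using hX by (metis dvd_smult diff_minus_eq_add mult_minus_right)
  then show ?thesis by blast
qed

text \<open>The relations in the corner rings are first brought to a common exponent \<open>M\<close>; their sum is a relation in \<open>R[t]\<close> because
  the idempotents add up to \<open>1\<close>.\<close>

lemma gSP_factorization_power_relation:
  fixes h :: "'a::comm_ring_1 poly"
  assumes "has_gSP_factorization h"
  shows "\<exists>K q. h dvd monom 1 K - monom 1 (Suc K) * q"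
proof -
  obtain E where fin: "finite E" and idem: "\<forall>e\<in>E. e * e = e" and sum: "\<Sum>E = (1::'a)"
    and SP: "\<forall>e\<in>E. \<exists>h0 p0. SP_factorization e (Polynomial.smult e h) h0 p0"
    using assms unfolding has_gSP_factorization_def complete_orthogonal_idempotents_def by blast
  have "\<forall>e\<in>E. \<exists>K. \<exists>q. h dvd Polynomial.smult e (monom 1 K) - monom 1 (Suc K) * q"
  proof
    fix e assume "e \<in> E"
    with SP obtain h0 p0 where "SP_factorization e (Polynomial.smult e h) h0 p0" by blast
    with idem \<open>e \<in> E\<close> show "\<exists>K. \<exists>q. h dvd Polynomial.smult e (monom 1 K) - monom 1 (Suc K) * q"
      by (intro SP_factorization_power_relation) simp
  qed
  from bchoice[OF this] obtain K
    where "\<forall>e\<in>E. \<exists>q. h dvd Polynomial.smult e (monom 1 (K e)) - monom 1 (Suc (K e)) * q"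
    by (rule exE)
  from bchoice[OF this] obtain q
    where Kq: "\<forall>e\<in>E. h dvd Polynomial.smult e (monom 1 (K e)) - monom 1 (Suc (K e)) * q e"
    by (rule exE)
  define M where "M = sum K E"
  have "h dvd Polynomial.smult e (monom 1 M) - monom 1 (Suc M) * q e" if "e \<in> E" for e
  proof -
    have "K e \<le> M" unfolding M_def using fin that by (simp add: member_le_sum)
    then have "Polynomial.smult e (monom 1 M) - monom 1 (Suc M) * q e
      = monom 1 (M - K e) * (Polynomial.smult e (monom 1 (K e)) - monom 1 (Suc (K e)) * q e)"
      by (simp add: right_diff_distrib mult_monom smult_monom flip: mult.assoc)
    then show ?thesis using Kq that by simp
  qed
  then have "h dvd (\<Sum>e\<in>E. Polynomial.smult e (monom 1 M) - monom 1 (Suc M) * q e)"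
    by (rule dvd_sum)
  also have "\<dots> = Polynomial.smult (\<Sum>E) (monom 1 M) - monom 1 (Suc M) * (\<Sum>e\<in>E. q e)"
    by (simp add: sum_subtractf sum_distrib_left smult_sum)
  finally show ?thesis unfolding sum by auto
qed

text \<open>By the Cayley-Hamilton theorem, evaluation at \<open>A\<close> turns a relation \<open>t\<^sup>K \<equiv> t\<^bsup>K+1\<^esup> q\<close> modulo the characteristic
  polynomial into \<open>A\<^sup>K = A\<^bsup>K+1\<^esup> q(A)\<close>, and \<open>q(A)\<close> commutes with \<open>A\<close>.\<close>

lemma strongly_pi_regular_if_gSP_factorization:
  fixes A :: "'a::comm_ring_1 mat"
  assumes A: "A \<in> carrier_mat n n" and gSP: "has_gSP_factorization (char_poly A)"
  shows "strongly_pi_regular (ring_mat TYPE('a) n ()) A"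
proof -
  interpret ring "ring_mat TYPE('a) n ()" by (rule ring_mat)
  obtain K q where "char_poly A dvd monom 1 K - monom 1 (Suc K) * q"
    using gSP_factorization_power_relation[OF gSP] by blast
  then obtain s where "monom 1 K - monom 1 (Suc K) * q = char_poly A * s" by (elim dvdE)
  then have K: "monom 1 K = monom 1 (Suc K) * q + char_poly A * s" by (simp add: algebra_simps)
  let ?Q = "mat_poly q A"
  have Q: "?Q \<in> carrier_mat n n" by (rule mat_poly_carrier[OF A])
  have z: "mat_poly (char_poly A) A * mat_poly s A = 0\<^sub>m n n"
    by (simp add: Cayley_Hamilton[OF A] left_mult_zero_mat[OF mat_poly_carrier[OF A]])
  have P: "A ^\<^sub>m k \<in> carrier_mat n n" for k using A by simp
  have "A ^\<^sub>m K = A ^\<^sub>m Suc K * ?Q"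
    using arg_cong[OF K, of "\<lambda>p. mat_poly p A"]
    by (simp only: mat_poly_add[OF A] z mat_poly_mult[OF A] mat_poly_monom[OF A]
        right_add_zero_mat[OF mult_carrier_mat[OF P Q]])
  moreover have "A ^\<^sub>m K = ?Q * A ^\<^sub>m Suc K"
    using arg_cong[OF K, of "\<lambda>p. mat_poly p A"]
    by (simp only: mult.commute[of "monom 1 (Suc K)" q] mat_poly_add[OF A] z mat_poly_mult[OF A] mat_poly_monom[OF A]
        right_add_zero_mat[OF mult_carrier_mat[OF Q P]])
  ultimately show ?thesis
    using strongly_pi_regularI[of A ?Q ?Q K] A Q
    by (simp only: ring_mat_simps pow_mat_ring_pow[OF A, of _ "()", symmetric])
qed

section \<open>Complementary idempotent matrices\<close>

definition complementary_idempotents :: "nat \<Rightarrow> 'b::comm_ring_1 mat \<Rightarrow> 'b mat \<Rightarrow> bool" where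
  "complementary_idempotents n E F \<longleftrightarrow> E \<in> carrier_mat n n \<and> F \<in> carrier_mat n n
    \<and> E * E = E \<and> F * F = F \<and> E * F = 0\<^sub>m n n \<and> F * E = 0\<^sub>m n n \<and> E + F = 1\<^sub>m n"

lemma complementary_idempotents_complement:
  fixes E :: "'b::comm_ring_1 mat"
  assumes E: "E \<in> carrier_mat n n" and EE: "E * E = E"
  shows "complementary_idempotents n E (1\<^sub>m n - E)"
proof -
  have F: "1\<^sub>m n - E \<in> carrier_mat n n" using E by (rule minus_carrier_mat)
  have EF: "E * (1\<^sub>m n - E) = 0\<^sub>m n n"
    using mult_minus_distrib_mat[OF E one_carrier_mat E] E by (simp add: EE)
  have FE: "(1\<^sub>m n - E) * E = 0\<^sub>m n n"
    using minus_mult_distrib_mat[OF one_carrier_mat E E] E by (simp add: EE)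
  have "(1\<^sub>m n - E) * (1\<^sub>m n - E) = 1\<^sub>m n - E"
    using minus_mult_distrib_mat[OF one_carrier_mat E F] E F by (simp add: EF) (auto intro!: eq_matI)
  moreover have "E + (1\<^sub>m n - E) = 1\<^sub>m n" using E by (auto intro!: eq_matI)
  ultimately show ?thesis using E F EE EF FE by (simp add: complementary_idempotents_def)
qed

lemma complementary_idempotents_hom:
  assumes "comm_ring_hom f" and EF: "complementary_idempotents n E F"
  shows "complementary_idempotents n (map_mat f E) (map_mat f F)"
proof -
  interpret comm_ring_hom f by fact
  have E: "E \<in> carrier_mat n n" and F: "F \<in> carrier_mat n n"
    using EF by (simp_all add: complementary_idempotents_def)
  have "map_mat f E + map_mat f F = map_mat f (E + F)"
    using E F by (auto simp: hom_add intro!: eq_matI)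
  moreover have "map_mat f (0\<^sub>m n n) = 0\<^sub>m n n" by (auto intro!: eq_matI)
  ultimately show ?thesis
    using EF E F unfolding complementary_idempotents_def
    by (simp add: mat_hom_one flip: mat_hom_mult)
qed

text \<open>Matrices that act separately on the two summands cut out by \<open>E\<close> and \<open>F\<close> multiply summand by summand. The
  factorizations of \<open>t - A\<close> and of \<open>det (t E + F)\<close> below are instances of this.\<close>

lemma mult_complementary_idempotents:
  fixes E :: "'b::comm_ring_1 mat"
  assumes EF: "complementary_idempotents n E F"
    and carr: "C \<in> carrier_mat n n" "D \<in> carrier_mat n n" "C' \<in> carrier_mat n n" "D' \<in> carrier_mat n n"
    and comm: "C * E = E * C" "C * F = F * C" "D * E = E * D" "D * F = F * D"
  shows "(E * C + F * D) * (E * C' + F * D') = E * (C * C') + F * (D * D')"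
proof -
  note EF = EF[unfolded complementary_idempotents_def]
  have E: "E \<in> carrier_mat n n" and F: "F \<in> carrier_mat n n" using EF by simp_all
  have swap: "(P * X) * (Q * Y) = (P * Q) * (X * Y)"
    if c: "P \<in> carrier_mat n n" "Q \<in> carrier_mat n n" "X \<in> carrier_mat n n" "Y \<in> carrier_mat n n"
      and XQ: "X * Q = Q * X" for P Q X Y :: "'b mat"
  proof -
    have "(P * X) * (Q * Y) = P * ((X * Q) * Y)"
      using c by (simp add: assoc_mult_mat[of _ n n _ n _ n])
    also have "\<dots> = (P * Q) * (X * Y)"
      unfolding XQ using c by (simp add: assoc_mult_mat[of _ n n _ n _ n])
    finally show ?thesis .
  qed
  have EC: "E * C \<in> carrier_mat n n" "F * D \<in> carrier_mat n n"
    "E * C' \<in> carrier_mat n n" "F * D' \<in> carrier_mat n n" using E F carr by simp_all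
  have "(E * C + F * D) * (E * C' + F * D')
    = (E * C * (E * C') + E * C * (F * D')) + (F * D * (E * C') + F * D * (F * D'))"
    unfolding add_mult_distrib_mat[OF EC(1,2) add_carrier_mat[OF EC(4)]]
      mult_add_distrib_mat[OF EC(1,3,4)] mult_add_distrib_mat[OF EC(2,3,4)] ..
  also have "\<dots> = (E * (C * C') + 0\<^sub>m n n) + (0\<^sub>m n n + F * (D * D'))"
    unfolding swap[OF E E carr(1,3) comm(1)] swap[OF E F carr(1,4) comm(2)]
      swap[OF F E carr(2,3) comm(3)] swap[OF F F carr(2,4) comm(4)]
    using EF left_mult_zero_mat[OF mult_carrier_mat[OF carr(1,4)]]
      left_mult_zero_mat[OF mult_carrier_mat[OF carr(2,3)]] by simp
  also have "\<dots> = E * (C * C') + F * (D * D')"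
    using E F carr by (auto intro!: eq_matI simp del: index_mult_mat(1))
  finally show ?thesis .
qed

lemma idempotent_pow_mult:
  fixes A :: "'b::comm_ring_1 mat"
  assumes A: "A \<in> carrier_mat n n" and F: "F \<in> carrier_mat n n"
    and FF: "F * F = F" and AF: "A * F = F * A"
  shows "(A * F) ^\<^sub>m Suc k = A ^\<^sub>m Suc k * F"
proof (induction k)
  case 0
  show ?case using A F by simp
next
  case (Suc k)
  have P: "A ^\<^sub>m Suc k \<in> carrier_mat n n" using A by (rule pow_carrier_mat)
  have "(A * F) ^\<^sub>m Suc (Suc k) = (A ^\<^sub>m Suc k * F) * (A * F)" using Suc.IH by simp
  also have "\<dots> = A ^\<^sub>m Suc k * ((F * A) * F)"
    using P A F by (simp add: assoc_mult_mat[of _ n n _ n _ n] del: pow_mat.simps)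
  also have "(F * A) * F = A * F"
    using A F by (simp add: AF[symmetric] assoc_mult_mat[of _ n n _ n _ n] FF)
  also have "A ^\<^sub>m Suc k * (A * F) = A ^\<^sub>m Suc (Suc k) * F"
    unfolding pow_mat.simps(2)[of A "Suc k"] by (rule assoc_mult_mat[OF P A F, symmetric])
  finally show ?case .
qed

section \<open>The rank polynomial of an idempotent matrix\<close>

lemma det_idempotent_combination_mult:
  fixes E :: "'b::comm_ring_1 mat"
  assumes EF: "complementary_idempotents n E F"
  shows "det (s \<cdot>\<^sub>m E + F) * det (s' \<cdot>\<^sub>m E + F) = det ((s * s') \<cdot>\<^sub>m E + F)"
proof -
  have E: "E \<in> carrier_mat n n" and F: "F \<in> carrier_mat n n"
    using EF by (simp_all add: complementary_idempotents_def)
  have scalar: "E * (t \<cdot>\<^sub>m 1\<^sub>m n) = t \<cdot>\<^sub>m E" for t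
    using mult_smult_distrib[OF E one_carrier_mat] E by simp
  have "(s \<cdot>\<^sub>m E + F) * (s' \<cdot>\<^sub>m E + F)
    = (E * (s \<cdot>\<^sub>m 1\<^sub>m n) + F * 1\<^sub>m n) * (E * (s' \<cdot>\<^sub>m 1\<^sub>m n) + F * 1\<^sub>m n)"
    using F by (simp add: scalar)
  also have "\<dots> = E * ((s \<cdot>\<^sub>m 1\<^sub>m n) * (s' \<cdot>\<^sub>m 1\<^sub>m n)) + F * (1\<^sub>m n * 1\<^sub>m n)"
    using E F
    by (intro mult_complementary_idempotents[OF EF])
       (simp_all add: mult_smult_distrib[of _ n n _ n] mult_smult_assoc_mat[of _ n n _ n])
  also have "(s \<cdot>\<^sub>m 1\<^sub>m n) * (s' \<cdot>\<^sub>m 1\<^sub>m n) = (s * s') \<cdot>\<^sub>m 1\<^sub>m n"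
    by (simp add: mult_smult_distrib[of _ n n _ n] mult_smult_assoc_mat[of _ n n _ n])
      (auto intro!: eq_matI)
  finally have "(s \<cdot>\<^sub>m E + F) * (s' \<cdot>\<^sub>m E + F) = (s * s') \<cdot>\<^sub>m E + F" using F by (simp add: scalar)
  then show ?thesis using det_mult[of "s \<cdot>\<^sub>m E + F" n "s' \<cdot>\<^sub>m E + F"] E F by simp
qed

lemma const_poly_hom: "comm_ring_hom (\<lambda>a::'a::comm_ring_1. [:a:])"
  by unfold_locales (auto simp: one_pCons)

text \<open>If \<open>E\<close> and \<open>F\<close> are complementary, this is \<open>det (t E + F)\<close>. Over a field it is \<open>t\<^sup>r\<close> for \<open>r\<close> the rank of \<open>E\<close>; over a ring
  with idempotents, its coefficient of degree \<open>j\<close> is the idempotent that cuts out the part of the ring over which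
  \<open>E\<close> has rank \<open>j\<close>.\<close>

definition rank_poly :: "'a::comm_ring_1 mat \<Rightarrow> 'a mat \<Rightarrow> 'a poly" where
  "rank_poly E F = det (monom 1 1 \<cdot>\<^sub>m map_mat (\<lambda>a. [:a:]) E + map_mat (\<lambda>a. [:a:]) F)"

context
  fixes n :: nat and E F :: "'a::comm_ring_1 mat"
  assumes EF: "complementary_idempotents n E F"
begin

lemma rank_poly_pcompose:
  "rank_poly E F \<circ>\<^sub>p s = det (s \<cdot>\<^sub>m map_mat (\<lambda>a. [:a:]) E + map_mat (\<lambda>a. [:a:]) F)"
proof -
  have E: "E \<in> carrier_mat n n" and F: "F \<in> carrier_mat n n"
    using EF by (simp_all add: complementary_idempotents_def)
  have "map_mat (\<lambda>p. p \<circ>\<^sub>p s) (monom 1 1 \<cdot>\<^sub>m map_mat (\<lambda>a. [:a:]) E + map_mat (\<lambda>a. [:a:]) F)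
      = s \<cdot>\<^sub>m map_mat (\<lambda>a. [:a:]) E + map_mat (\<lambda>a. [:a:]) F"
    using E F by (auto intro!: eq_matI simp: pcompose_add monom_altdef pcompose_pCons)
  then show ?thesis
    unfolding rank_poly_def by (metis comm_ring_hom.hom_det[OF pcompose_hom.comm_ring_hom_axioms])
qed

lemma rank_poly_pcompose_mult:
  "(rank_poly E F \<circ>\<^sub>p s) * (rank_poly E F \<circ>\<^sub>p s') = rank_poly E F \<circ>\<^sub>p (s * s')"
  unfolding rank_poly_pcompose
  by (rule det_idempotent_combination_mult[OF complementary_idempotents_hom[OF const_poly_hom EF]])

lemma degree_rank_poly: "degree (rank_poly E F) \<le> n"
proof -
  have E: "E \<in> carrier_mat n n" and F: "F \<in> carrier_mat n n"
    using EF by (simp_all add: complementary_idempotents_def)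
  have "degree (rank_poly E F) \<le> 1 * n" unfolding rank_poly_def
    by (rule degree_det_le) (use E F in \<open>auto simp: monom_altdef intro!: degree_add_le degree_pCons_le le_trans[OF degree_pCons_le]\<close>)
  then show ?thesis by simp
qed

lemma poly_rank_poly_1: "poly (rank_poly E F) 1 = 1"
proof -
  have E: "E \<in> carrier_mat n n" and F: "F \<in> carrier_mat n n" and sum: "E + F = 1\<^sub>m n"
    using EF by (simp_all add: complementary_idempotents_def)
  have "poly (rank_poly E F) 1 = det (E + F)" unfolding rank_poly_def
    by (rule poly_det_cong[of _ n]) (use E F in \<open>auto simp: poly_monom\<close>)
  then show ?thesis by (simp add: sum)
qed

text \<open>With \<open>r(t) = det (t E + F)\<close> one has \<open>r(s) r(s') = r(s s')\<close>. For two independent variables this says that the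
  coefficients are orthogonal idempotents. One variable suffices: substitute \<open>s = t\<close> and \<open>s' = t\<^sup>M\<close> with
  \<open>M > n\<close>; since \<open>r\<close> has degree at most \<open>n\<close>, the exponents \<open>M j + i\<close> for \<open>i, j \<le> n\<close> are distinct, so that the
  coefficient of the product at \<open>M j + i\<close> is \<open>r\<^sub>i r\<^sub>j\<close>. On the right hand side only exponents \<open>(M + 1) k\<close> occur.\<close>

lemma rank_poly_coeff_mult:
  assumes "i \<le> n" "j \<le> n"
  shows "coeff (rank_poly E F) i * coeff (rank_poly E F) j = (if i = j then coeff (rank_poly E F) i else 0)"
proof -
  let ?r = "rank_poly E F"
  define M where "M = Suc n"
  \<comment> \<open>The coefficients of \<open>r(t\<^sup>N)\<close>, indexed by quotient and remainder modulo \<open>N\<close>.\<close>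
  have spread: "coeff (?r \<circ>\<^sub>p monom 1 N) (N * a + b) = (if b = 0 then coeff ?r a else 0)"
    if "b < N" for N a b using that by (rule coeff_pcompose_monom)
  have id: "?r \<circ>\<^sub>p monom 1 1 = ?r" by (simp add: monom_altdef)
  have "?r * (?r \<circ>\<^sub>p monom 1 M) = ?r \<circ>\<^sub>p (monom 1 1 * monom 1 M)"
    using rank_poly_pcompose_mult[of "monom 1 1" "monom 1 M"] unfolding id .
  then have eq: "?r * (?r \<circ>\<^sub>p monom 1 M) = ?r \<circ>\<^sub>p monom 1 (Suc M)" by (simp add: mult_monom)
  have "coeff (?r * (?r \<circ>\<^sub>p monom 1 M)) (M * j + i)
    = (\<Sum>k\<le>M * j + i. coeff ?r k * coeff (?r \<circ>\<^sub>p monom 1 M) (M * j + i - k))"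
    by (rule coeff_mult)
  also have "\<dots> = (\<Sum>k\<in>{i}. coeff ?r k * coeff (?r \<circ>\<^sub>p monom 1 M) (M * j + i - k))"
  proof (rule sum.mono_neutral_right)
    show "\<forall>k\<in>{..M * j + i} - {i}. coeff ?r k * coeff (?r \<circ>\<^sub>p monom 1 M) (M * j + i - k) = 0"
    proof
      fix k assume k: "k \<in> {..M * j + i} - {i}"
      consider "n < k" | "k < i" | "i < k" "k \<le> n" using k by force
      then show "coeff ?r k * coeff (?r \<circ>\<^sub>p monom 1 M) (M * j + i - k) = 0"
      proof cases
        case 1
        then show ?thesis using degree_rank_poly by (simp add: coeff_eq_0)
      next
        case 2
        then have "M * j + i - k = M * j + (i - k)" by simp
        then show ?thesis using spread[of "i - k" M j] 2 assms by (simp add: M_def)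
      next
        case 3
        then obtain j' where j: "j = Suc j'" using k by (cases j) auto
        have "M * j + i - k = M * j' + (M - (k - i))" using 3 by (simp add: j M_def)
        then show ?thesis using spread[of "M - (k - i)" M j'] 3 by (simp add: M_def)
      qed
    qed
  qed auto
  also have "\<dots> = coeff ?r i * coeff ?r j" using spread[of 0 M j] by (simp add: M_def)
  finally have prod: "coeff ?r i * coeff ?r j = coeff (?r \<circ>\<^sub>p monom 1 (Suc M)) (M * j + i)"
    by (simp add: eq)
  consider "i = j" | "j < i" | "i < j" by linarith
  then show ?thesis
  proof cases
    case 1
    have idx: "M * j + i = Suc M * i + 0" using 1 by simp
    show ?thesis unfolding prod idx using spread[of 0 "Suc M" i] 1 by simp
  next
    case 2
    have idx: "M * j + i = Suc M * j + (i - j)" using 2 by simp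
    show ?thesis unfolding prod idx using spread[of "i - j" "Suc M" j] 2 assms
      by (simp add: M_def)
  next
    case 3
    then obtain j' where j: "j = Suc j'" by (cases j) auto
    have idx: "M * j + i = Suc M * j' + (Suc M - (j - i))" using 3 assms by (simp add: j M_def)
    show ?thesis unfolding prod idx using spread[of "Suc M - (j - i)" "Suc M" j'] 3 assms
      by (simp add: M_def)
  qed
qed

text \<open>Distinct indices with equal coefficients occur only for the coefficient \<open>0\<close>, by orthogonality, so that the sum over the
  set of coefficients is the sum of all coefficients, which is the value at \<open>1\<close>.\<close>

lemma rank_poly_coeffs_complete_orthogonal:
  "complete_orthogonal_idempotents (coeff (rank_poly E F) ` {..n})"
proof -
  let ?f = "coeff (rank_poly E F)"
  have "(\<Sum>e\<in>?f ` {..n}. e) = (\<Sum>j\<le>n. ?f j)"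
  proof (subst sum.reindex_nontrivial)
    fix i j assume "i \<in> {..n}" "j \<in> {..n}" "i \<noteq> j" "?f i = ?f j"
    then show "?f i = 0" using rank_poly_coeff_mult[of i i] rank_poly_coeff_mult[of i j] by simp
  qed simp_all
  also have "\<dots> = (\<Sum>j\<le>degree (rank_poly E F). ?f j)"
    by (rule sum.mono_neutral_right) (use degree_rank_poly in \<open>auto simp: coeff_eq_0\<close>)
  also have "\<dots> = 1" using poly_rank_poly_1 by (simp add: poly_altdef)
  finally have "\<Sum>(?f ` {..n}) = 1" .
  moreover have "e * e = e" if "e \<in> ?f ` {..n}" for e
    using that rank_poly_coeff_mult by fastforce
  moreover have "e * e' = 0" if "e \<in> ?f ` {..n}" "e' \<in> ?f ` {..n}" "e \<noteq> e'" for e e'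
  proof -
    from that(1) obtain i where i: "i \<le> n" "e = ?f i" by blast
    from that(2) obtain j where j: "j \<le> n" "e' = ?f j" by blast
    have "i \<noteq> j" using that(3) i(2) j(2) by blast
    then show ?thesis unfolding i(2) j(2) using rank_poly_coeff_mult[OF i(1) j(1)] by simp
  qed
  moreover have "finite (?f ` {..n})" by simp
  ultimately show ?thesis unfolding complete_orthogonal_idempotents_def by blast
qed

end

section \<open>Nilpotent matrices\<close>

lemma char_poly_matrix_alt:
  "A \<in> carrier_mat n n \<Longrightarrow> char_poly_matrix A = monom 1 1 \<cdot>\<^sub>m 1\<^sub>m n - map_mat (\<lambda>a. [:a:]) A"
  by (rule eq_matI) (auto simp: char_poly_matrix_def monom_altdef)

text \<open>From \<open>N\<^sup>m = 0\<close> the geometric sum \<open>S\<close> satisfies \<open>S (t - N) = t\<^sup>m - N\<^sup>m = t\<^sup>m\<close>; take determinants.\<close>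

lemma char_poly_dvd_monom:
  fixes N :: "'a::comm_ring_1 mat"
  assumes N: "N \<in> carrier_mat n n" and nil: "N ^\<^sub>m m = 0\<^sub>m n n"
  shows "char_poly N dvd monom 1 (m * n)"
proof -
  interpret comm_ring_hom "\<lambda>a::'a. [:a:]" by (rule const_poly_hom)
  let ?c = "map_mat (\<lambda>a::'a. [:a:])"
  let ?X = "char_poly_matrix N"
  have X: "?X \<in> carrier_mat n n" using N by simp
  have "\<exists>S\<in>carrier_mat n n. S * ?X = monom 1 k \<cdot>\<^sub>m 1\<^sub>m n - ?c (N ^\<^sub>m k)" for k
  proof (induction k)
    case 0
    have "monom 1 0 \<cdot>\<^sub>m 1\<^sub>m n - ?c (N ^\<^sub>m 0) = 0\<^sub>m n n"
      using N by (intro eq_matI) auto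
    then have "0\<^sub>m n n * ?X = monom 1 0 \<cdot>\<^sub>m 1\<^sub>m n - ?c (N ^\<^sub>m 0)"
      using left_mult_zero_mat[OF X] by simp
    then show ?case by (intro bexI[of _ "0\<^sub>m n n"]) simp_all
  next
    case (Suc k)
    then obtain S where S: "S \<in> carrier_mat n n" "S * ?X = monom 1 k \<cdot>\<^sub>m 1\<^sub>m n - ?c (N ^\<^sub>m k)" by blast
    let ?P = "?c (N ^\<^sub>m k)"
    have P: "?P \<in> carrier_mat n n" and cN: "?c N \<in> carrier_mat n n" using N by simp_all
    have PX: "?P * ?X = monom 1 1 \<cdot>\<^sub>m ?P - ?c (N ^\<^sub>m Suc k)"
    proof -
      have "?P * ?X = ?P * (monom 1 1 \<cdot>\<^sub>m 1\<^sub>m n) - ?P * ?c N"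
        unfolding char_poly_matrix_alt[OF N] by (rule mult_minus_distrib_mat[OF P _ cN]) simp
      also have "?P * (monom 1 1 \<cdot>\<^sub>m 1\<^sub>m n) = monom 1 1 \<cdot>\<^sub>m ?P"
        unfolding mult_smult_distrib[OF P one_carrier_mat] right_mult_one_mat[OF P] ..
      also have "?P * ?c N = ?c (N ^\<^sub>m Suc k)"
        using mat_hom_mult[of "N ^\<^sub>m k" n n N n] N by simp
      finally show ?thesis .
    qed
    have "(monom 1 1 \<cdot>\<^sub>m S + ?P) * ?X = monom 1 1 \<cdot>\<^sub>m (S * ?X) + ?P * ?X"
      using S P X by (simp add: add_mult_distrib_mat[of _ n n _ _ n] mult_smult_assoc_mat[of _ n n _ n])
    also have "\<dots> = monom 1 (Suc k) \<cdot>\<^sub>m 1\<^sub>m n - ?c (N ^\<^sub>m Suc k)"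
      unfolding S(2) PX using N
      by (auto intro!: eq_matI simp: right_diff_distrib mult_monom simp del: pow_mat.simps)
    finally show ?case using S P by (intro bexI[of _ "monom 1 1 \<cdot>\<^sub>m S + ?P"]) simp_all
  qed
  then obtain S where S: "S \<in> carrier_mat n n" "S * ?X = monom 1 m \<cdot>\<^sub>m 1\<^sub>m n - ?c (N ^\<^sub>m m)" by blast
  have "monom 1 m \<cdot>\<^sub>m 1\<^sub>m n - ?c (N ^\<^sub>m m) = monom 1 m \<cdot>\<^sub>m 1\<^sub>m n"
    unfolding nil by (auto intro!: eq_matI)
  then have "det S * char_poly N = det (monom 1 m \<cdot>\<^sub>m 1\<^sub>m n)"
    using det_mult[OF S(1) X] S(2) by (simp add: char_poly_def)
  also have "\<dots> = monom 1 (m * n)" by (simp add: monom_power)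
  finally show ?thesis by (metis dvd_triv_right)
qed

lemma char_poly_nilpotent:
  fixes N :: "'a::comm_ring_1 mat"
  assumes N: "N \<in> carrier_mat n n" and nil: "N ^\<^sub>m m = 0\<^sub>m n n" and "i \<noteq> n"
  shows "\<exists>k. coeff (char_poly N) i ^ k = 0"
proof (cases "i < n")
  case True
  with degree_monic_char_poly[OF N] show ?thesis
    by (intro monic_dvd_monom_nilpotent[OF _ char_poly_dvd_monom[OF N nil]]) auto
next
  case False
  then have "coeff (char_poly N) i = 0"
    using \<open>i \<noteq> n\<close> degree_monic_char_poly[OF N] by (intro coeff_eq_0) auto
  then show ?thesis by (intro exI[of _ 1]) simp
qed

section \<open>Factoring the characteristic polynomial\<close>

text \<open>Let \<open>E\<close> be the spectral idempotent of \<open>A\<close> and \<open>F = 1 - E\<close>, so that \<open>A\<close> is invertible on the image of \<open>E\<close> and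
  \<open>N = A F\<close> is nilpotent. With \<open>U = E (t - A) + F\<close> and \<open>V = E + F (t - A)\<close> one has \<open>U V = t - A\<close>. The value of
  \<open>det U\<close> at \<open>0\<close> is a unit. Further \<open>V (t E + F) = t - N\<close>, so \<open>det V\<close> times the rank polynomial of \<open>E\<close> is the
  characteristic polynomial of \<open>N\<close>, which is \<open>t\<^sup>n\<close> up to nilpotent coefficients. Multiplying by the \<open>j\<close>-th coefficient \<open>e\<close>
  of the rank polynomial turns that polynomial into \<open>e t\<^sup>j\<close>, and hence \<open>e det V\<close> into \<open>e t\<^bsup>n-j\<^esup>\<close> up to nilpotent
  coefficients.\<close>

lemma gSP_factorization_if_strongly_pi_regular:
  fixes A :: "'a::comm_ring_1 mat"
  assumes A: "A \<in> carrier_mat n n" and spr: "strongly_pi_regular (ring_mat TYPE('a) n ()) A"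
  shows "has_gSP_factorization (char_poly A)"
proof -
  interpret R: ring "ring_mat TYPE('a) n ()" by (rule ring_mat)
  obtain E Z and m :: nat where E: "E \<in> carrier_mat n n" and Z: "Z \<in> carrier_mat n n"
    and EE: "E * E = E" and AE: "A * E = E * A" and EAZ: "E * A * Z = E"
    and AmE: "A ^\<^sub>m m * E = A ^\<^sub>m m" and "1 \<le> m"
    using R.strongly_pi_regular_spectral_idempotent[OF spr]
    unfolding ring_mat_simps pow_mat_ring_pow[OF A, of _ "()", symmetric] by blast
  define F where "F = 1\<^sub>m n - E"
  have EF: "complementary_idempotents n E F"
    unfolding F_def by (rule complementary_idempotents_complement[OF E EE])
  then have F: "F \<in> carrier_mat n n" and FF: "F * F = F" and sum: "E + F = 1\<^sub>m n"
    and EF0: "E * F = 0\<^sub>m n n" by (simp_all add: complementary_idempotents_def)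
  have AF: "A * F = F * A"
    unfolding F_def using A E
    by (simp add: mult_minus_distrib_mat[of _ n n _ n] minus_mult_distrib_mat[of _ n n _ _ n] AE)
  define N where "N = A * F"
  have N: "N \<in> carrier_mat n n" using A F by (simp add: N_def)
  have nil: "N ^\<^sub>m m = 0\<^sub>m n n"
  proof -
    have Am: "A ^\<^sub>m m \<in> carrier_mat n n" using A by simp
    have "N ^\<^sub>m m = A ^\<^sub>m m * F"
      using idempotent_pow_mult[OF A F FF AF, of "m - 1"] \<open>1 \<le> m\<close> by (simp add: N_def)
    also have "\<dots> = A ^\<^sub>m m * (E * F)"
      using assoc_mult_mat[OF Am E F] AmE by simp
    also have "\<dots> = 0\<^sub>m n n" unfolding EF0 by (rule right_mult_zero_mat[OF Am])
    finally show ?thesis .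
  qed
  interpret c: comm_ring_hom "\<lambda>a::'a. [:a:]" by (rule const_poly_hom)
  let ?c = "map_mat (\<lambda>a::'a. [:a:])"
  have EF': "complementary_idempotents n (?c E) (?c F)"
    by (rule complementary_idempotents_hom[OF const_poly_hom EF])
  then have sum': "?c E + ?c F = 1\<^sub>m n" by (simp add: complementary_idempotents_def)
  have E': "?c E \<in> carrier_mat n n" and F': "?c F \<in> carrier_mat n n" and A': "?c A \<in> carrier_mat n n"
    using A E F by simp_all
  let ?X = "char_poly_matrix A"
  have X: "?X \<in> carrier_mat n n" using A by simp
  have X_eq: "?X = monom 1 1 \<cdot>\<^sub>m 1\<^sub>m n - ?c A" by (rule char_poly_matrix_alt[OF A])
  have T: "monom 1 1 \<cdot>\<^sub>m 1\<^sub>m n \<in> carrier_mat n n" by simp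
  have T_left: "(monom 1 1 \<cdot>\<^sub>m 1\<^sub>m n) * P = monom 1 1 \<cdot>\<^sub>m P"
    and T_right: "P * (monom 1 1 \<cdot>\<^sub>m 1\<^sub>m n) = monom 1 1 \<cdot>\<^sub>m P"
    if P: "P \<in> carrier_mat n n" for P :: "'a poly mat"
    unfolding mult_smult_distrib[OF P one_carrier_mat] mult_smult_assoc_mat[OF one_carrier_mat P]
      right_mult_one_mat[OF P] left_mult_one_mat[OF P] by simp_all
  have X_comm: "?X * ?c P = ?c P * ?X" if P: "P \<in> carrier_mat n n" and AP: "A * P = P * A" for P
  proof -
    have P': "?c P \<in> carrier_mat n n" using P by simp
    have "?c A * ?c P = ?c P * ?c A"
      using c.mat_hom_mult[OF A P] c.mat_hom_mult[OF P A] AP by simp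
    then show ?thesis
      unfolding X_eq minus_mult_distrib_mat[OF T A' P'] mult_minus_distrib_mat[OF P' T A']
        T_left[OF P'] T_right[OF P'] by simp
  qed
  note XE = X_comm[OF E AE] and XF = X_comm[OF F AF]
  define U where "U = ?c E * ?X + ?c F * 1\<^sub>m n"
  define V where "V = ?c E * 1\<^sub>m n + ?c F * ?X"
  define W where "W = monom 1 1 \<cdot>\<^sub>m ?c E + ?c F"
  have carr: "U \<in> carrier_mat n n" "V \<in> carrier_mat n n" "W \<in> carrier_mat n n"
    using E' F' X by (simp_all add: U_def V_def W_def)
  have one: "1\<^sub>m n * P = P" "P * 1\<^sub>m n = P" if "P \<in> carrier_mat n n" for P :: "'a poly mat"
    using that by simp_all
  have "U * V = ?c E * (?X * 1\<^sub>m n) + ?c F * (1\<^sub>m n * ?X)"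
    unfolding U_def V_def
    by (rule mult_complementary_idempotents[OF EF']) (simp_all only: X one_carrier_mat XE XF one E' F')
  also have "\<dots> = ?X"
    unfolding one[OF X] add_mult_distrib_mat[OF E' F' X, symmetric] sum' ..
  finally have UV: "char_poly A = det U * det V"
    unfolding char_poly_def using det_mult[OF carr(1,2)] by simp
  have "V * W = (?c E * 1\<^sub>m n + ?c F * ?X) * (?c E * (monom 1 1 \<cdot>\<^sub>m 1\<^sub>m n) + ?c F * 1\<^sub>m n)"
    unfolding V_def W_def T_right[OF E'] one[OF F'] ..
  also have "\<dots> = ?c E * (1\<^sub>m n * (monom 1 1 \<cdot>\<^sub>m 1\<^sub>m n)) + ?c F * (?X * 1\<^sub>m n)"
    by (rule mult_complementary_idempotents[OF EF']) (simp_all only: X T one_carrier_mat XE XF one E' F')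
  also have "\<dots> = monom 1 1 \<cdot>\<^sub>m ?c E + (monom 1 1 \<cdot>\<^sub>m ?c F - ?c N)"
  proof -
    have "?c F * ?X = monom 1 1 \<cdot>\<^sub>m ?c F - ?c N"
      unfolding X_eq mult_minus_distrib_mat[OF F' T A'] T_right[OF F'] N_def AF c.mat_hom_mult[OF F A] ..
    then show ?thesis unfolding one[OF X] one[OF T] T_right[OF E'] by simp
  qed
  also have "\<dots> = monom 1 1 \<cdot>\<^sub>m (?c E + ?c F) - ?c N"
    using E F N by (auto intro!: eq_matI simp: smult_add_left)
  also have "\<dots> = char_poly_matrix N" unfolding sum' by (rule char_poly_matrix_alt[OF N, symmetric])
  finally have VW: "det V * rank_poly E F = char_poly N"
    unfolding char_poly_def rank_poly_def using det_mult[OF carr(2,3)] by (simp add: W_def)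
  obtain w where w: "poly (det U) 0 * w = 1"
  proof
    have "map_mat (\<lambda>p. poly p 0) U = E * (- A) + F"
    proof -
      have "map_mat (\<lambda>p. poly p 0) (?c E * ?X) = E * (- A)"
      proof -
        have "map_mat (\<lambda>p. poly p 0) (?c E) = E" using E by (auto intro!: eq_matI)
        moreover have "map_mat (\<lambda>p. poly p 0) ?X = - A"
          using A by (auto intro!: eq_matI simp: char_poly_matrix_def)
        ultimately show ?thesis using semiring_hom.mat_hom_mult[OF poly_hom.semiring_hom_axioms E' X, of 0] by simp
      qed
      moreover have "map_mat (\<lambda>p. poly p 0) (?c F) = F" using F by (auto intro!: eq_matI)
      moreover have "map_mat (\<lambda>p. poly p 0) (P + Q)
          = map_mat (\<lambda>p. poly p 0) P + map_mat (\<lambda>p. poly p 0) Q"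
        if "P \<in> carrier_mat n n" "Q \<in> carrier_mat n n" for P Q :: "'a poly mat"
        using that by (auto intro!: eq_matI)
      note this[OF mult_carrier_mat[OF E' X] F']
      ultimately show ?thesis unfolding U_def one[OF F'] by simp
    qed
    then have "poly (det U) 0 = det (E * (- A) + F * 1\<^sub>m n)"
      using F comm_ring_hom.hom_det[OF poly_hom.comm_ring_hom_axioms, of 0 U] by simp
    then have "poly (det U) 0 * det (E * (- Z) + F * 1\<^sub>m n)
      = det ((E * (- A) + F * 1\<^sub>m n) * (E * (- Z) + F * 1\<^sub>m n))"
      using det_mult[of "E * (- A) + F * 1\<^sub>m n" n "E * (- Z) + F * 1\<^sub>m n"] A E F Z by simp
    also have "(E * (- A) + F * 1\<^sub>m n) * (E * (- Z) + F * 1\<^sub>m n)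
      = E * (- A * - Z) + F * (1\<^sub>m n * 1\<^sub>m n)"
      by (rule mult_complementary_idempotents[OF EF])
        (use A Z E F AE AF in \<open>simp_all add: uminus_mult_left_mat uminus_mult_right_mat\<close>)
    also have "- A * - Z = A * Z"
      using A Z by (auto intro!: eq_matI simp: scalar_prod_def)
    also have "E * (A * Z) + F * (1\<^sub>m n * 1\<^sub>m n) = 1\<^sub>m n"
      using assoc_mult_mat[OF E A Z] EAZ F sum by simp
    finally show "poly (det U) 0 * det (E * (- Z) + F * 1\<^sub>m n) = 1" by simp
  qed
  note chi = degree_monic_char_poly[OF N]
  have "\<exists>h0 p0. SP_factorization (coeff (rank_poly E F) j) (Polynomial.smult (coeff (rank_poly E F) j) (char_poly A)) h0 p0"
    if "j \<le> n" for j
  proof -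
    define e where "e = coeff (rank_poly E F) j"
    have ee: "e * e = e" unfolding e_def using rank_poly_coeff_mult[OF EF that that] by simp
    define h0 where "h0 = Polynomial.smult e (det U)"
    define p0 where "p0 = Polynomial.smult e (det V)"
    have "Polynomial.smult e (rank_poly E F) = monom e j"
    proof (rule poly_eqI)
      fix i
      show "coeff (Polynomial.smult e (rank_poly E F)) i = coeff (monom e j) i"
      proof (cases "i \<le> n")
        case True
        then show ?thesis using rank_poly_coeff_mult[OF EF that True] by (simp add: e_def)
      next
        case False
        then show ?thesis using degree_rank_poly[OF EF] that by (simp add: coeff_eq_0)
      qed
    qed
    then have "p0 * monom e j = Polynomial.smult (e * e) (char_poly N)"
      unfolding p0_def VW[symmetric] by (metis mult_smult_left mult_smult_right smult_smult)
    moreover have "p0 * monom e j = monom 1 j * p0"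
      unfolding p0_def
      by (metis ee mult.commute mult_smult_left mult_smult_right smult_monom smult_smult mult.right_neutral)
    ultimately have shift: "monom 1 j * p0 = Polynomial.smult e (char_poly N)" by (simp add: ee)
    have coeff_p0: "coeff p0 i = e * coeff (char_poly N) (i + j)" for i
      using arg_cong[OF shift, of "\<lambda>p. coeff p (i + j)"] by (simp add: coeff_monom_mult)
    \<comment> \<open>For \<open>e = 0\<close> the degree of \<open>p0\<close> is \<open>0\<close>, but both monomials vanish.\<close>
    have deg: "monom e (degree p0) = monom e (n - j)"
    proof (cases "e = 0")
      case False
      have "degree p0 = n - j"
      proof (rule antisym)
        show "degree p0 \<le> n - j"
          by (rule degree_le) (use chi that in \<open>simp add: coeff_p0 coeff_eq_0\<close>)
        show "n - j \<le> degree p0"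
          by (rule le_degree) (use chi that False in \<open>simp add: coeff_p0\<close>)
      qed
      then show ?thesis by simp
    qed simp
    have "\<exists>k. coeff (p0 - monom e (degree p0)) i ^ k = 0" for i
    proof (cases "i = n - j")
      case True
      then have "coeff (p0 - monom e (degree p0)) i = 0"
        unfolding deg using chi that by (simp add: coeff_p0)
      then show ?thesis by (intro exI[of _ 1]) simp
    next
      case False
      then have "i + j \<noteq> n" using that by simp
      then obtain k where k: "coeff (char_poly N) (i + j) ^ k = 0"
        using char_poly_nilpotent[OF N nil] by blast
      have "coeff (p0 - monom e (degree p0)) i = e * coeff (char_poly N) (i + j)"
        unfolding deg using False by (simp add: coeff_p0)
      then show ?thesis using k by (metis mult_zero_right power_mult_distrib)
    qed
    moreover have "poly h0 0 * w = e" using w by (simp add: h0_def mult.assoc)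
    moreover have "Polynomial.smult e (char_poly A) = h0 * p0"
      by (simp add: h0_def p0_def UV ee)
    ultimately have "SP_factorization e (Polynomial.smult e (char_poly A)) h0 p0"
      unfolding SP_factorization_iff[OF ee] by (auto simp: h0_def p0_def ee)
    then show ?thesis unfolding e_def by blast
  qed
  then show ?thesis
    unfolding has_gSP_factorization_def
    using rank_poly_coeffs_complete_orthogonal[OF EF] by blast
qed

theorem proposition14:
  fixes h :: "'a::comm_ring_1 poly" and n :: nat
  assumes "clean_ring TYPE('a)"
    and "monic h" and "degree h = n"
  shows "((\<forall>A \<in> carrier_mat n n. char_poly A = h \<longrightarrow>
             strongly_pi_regular (ring_mat TYPE('a) n ()) A)
          \<longleftrightarrow> (\<exists>A \<in> carrier_mat n n. char_poly A = h \<and>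
             strongly_pi_regular (ring_mat TYPE('a) n ()) A))
       \<and> ((\<exists>A \<in> carrier_mat n n. char_poly A = h \<and>
             strongly_pi_regular (ring_mat TYPE('a) n ()) A)
          \<longleftrightarrow> has_gSP_factorization h)"
proof -
  obtain C where C: "C \<in> carrier_mat n n" "char_poly C = h"
    using companion_matrix_exists[OF assms(2,3)] by blast
  have "strongly_pi_regular (ring_mat TYPE('a) n ()) A \<longleftrightarrow> has_gSP_factorization h"
    if "A \<in> carrier_mat n n" "char_poly A = h" for A
    using that gSP_factorization_if_strongly_pi_regular[of A n]
      strongly_pi_regular_if_gSP_factorization[of A n] by metis
  with C show ?thesis by metis
qed

end
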